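(* Let $p$ be a prime, let $a\in\mathbb{Z}$ be such that $f(x)=x^p-a$ is irreducible in $\mathbb{Z}[x]$, and let $f^n$ denote the $n$-fold composition of $f$ with itself. For each $n\ge 1$ let $\alpha_n$ be a root of $f^n(x)$ and $K_n=\mathbb{Q}(\alpha_n)$, with ring of integers $\mathcal{O}_{K_n}$. Fix a natural number $N\geq 1$. Then $\mathcal{O}_{K_n}=\mathbb{Z}[\alpha_n]$ for all $1\le n\leq N$ if and only if $a^p\not\equiv a \pmod{p^2}$ and $f^n(0)$ is squarefree for all $1\le n\leq N$.
   Context: $f^n=f\circ f\circ\cdots\circ f$ ($n$ times). Since $f$ is irreducible, every iterate $f^n(x)$ is irreducible in $\mathbb{Z}[x]$, so $K_n$ has degree $p^n$ over $\mathbb{Q}$. *)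

theory Defs
  imports
    "HOL-Algebra.Algebraic_Closure_Type"
    "HOL-Algebra.Generated_Fields"
    "HOL-Computational_Algebra.Computational_Algebra"
    "HOL-Number_Theory.Cong"
    Complex_Main
begin

hide_const (open)
  Divisibility.prime Divisibility.irreducible

definition poly_iterate :: "'a :: comm_semiring_1 poly \<Rightarrow> nat \<Rightarrow> 'a poly" where
  "poly_iterate f n = (pcompose f ^^ n) [:0, 1:]"

text \<open>Number fields are realised as subfields of the complex numbers; the library's generated
  subrings and subfields are taken inside the complex field viewed as a ring record.\<close>

definition int_adjoin :: "complex \<Rightarrow> complex set" where
  "int_adjoin \<alpha> = generate_ring ring_of_type_algebra {\<alpha>}"

definition rat_adjoin :: "complex \<Rightarrow> complex set" where
  "rat_adjoin \<alpha> = generate_field ring_of_type_algebra {\<alpha>}"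

definition ring_of_integers :: "complex set \<Rightarrow> complex set" where
  "ring_of_integers K = {x \<in> K. algebraic_int x}"

end

theory Submission
  imports Defs "Jordan_Normal_Form.Char_Poly"
begin

text \<open>
  Write \<open>g = f\<^sup>n\<close>. By Dedekind's criterion, \<open>\<int>[\<alpha>]\<close> is the full ring of integers iff \<open>g\<close> lies in
  no square \<open>(q, \<pi>)\<^sup>2\<close> of a maximal ideal of \<open>\<int>[X]\<close>.

  Modulo \<open>p\<close> one has \<open>g = (X - na)^(p^n)\<close>, and \<open>g(na) = a^p - a\<close> modulo \<open>p\<^sup>2\<close>, so \<open>a^p \<noteq> a\<close> modulo \<open>p\<^sup>2\<close>
  makes \<open>g(X + na)\<close> an Eisenstein polynomial at \<open>p\<close>; this gives irreducibility of all iterates and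
  handles \<open>q = p\<close>. For \<open>q \<noteq> p\<close>, if \<open>g \<in> (q, \<pi>)\<^sup>2\<close> then \<open>g' = p^n * (\<Prod>k<n. (f\<^sup>k)^(p-1))\<close> is in
  \<open>(q, \<pi>)\<close>, hence so is some \<open>Y = f\<^sup>k\<close>. Since \<open>g = f\<^sup>n\<^sup>-\<^sup>k(0)\<close> modulo \<open>Y\<^sup>2\<close>, the integer
  \<open>f\<^sup>n\<^sup>-\<^sup>k(0)\<close> lies in \<open>(q, \<pi>)\<^sup>2\<close>, that is, it is divisible by \<open>q\<^sup>2\<close>.

  Conversely, \<open>f \<in> (p, X - a)\<^sup>2\<close> if \<open>a^p = a\<close> modulo \<open>p\<^sup>2\<close>, and \<open>g \<in> (q, X)\<^sup>2\<close> if \<open>q\<^sup>2\<close> divides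
  \<open>g(0)\<close>, because \<open>g'(0) = 0\<close>.
\<close>

section \<open>Algebraic integers\<close>

text \<open>The complex numbers as a module over the integers: spans are additive subgroups, and
  finitely generated ones play the role of lattices below.\<close>

interpretation int_module: Modules.module "\<lambda>(n::int) (x::complex). of_int n * x"
  by unfold_locales (auto simp: algebra_simps)

text \<open>The interpreted rule reassociates products and makes simplification with \<open>ac_simps\<close> loop.\<close>
declare int_module.scale_scale [simp del]

abbreviation ev :: "int poly \<Rightarrow> complex \<Rightarrow> complex" where
  "ev h x \<equiv> poly (map_poly of_int h) x"

lemma ev_simps:
  "ev (h + k) x = ev h x + ev k x" "ev (h - k) x = ev h x - ev k x" "ev (- h) x = - ev h x"
  "ev (h * k) x = ev h x * ev k x" "ev (h ^ n) x = ev h x ^ n" "ev [:c:] x = of_int c"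
  "ev 0 x = 0" "ev 1 x = 1" "ev (smult c h) x = of_int c * ev h x" "ev (monom c n) x = of_int c * x ^ n"
  "ev (pCons c h) x = of_int c + x * ev h x"
  by (simp_all add: hom_distribs poly_monom map_poly_monom)

text \<open>Determinant trick. Integer coefficients for the products \<open>x * s\<close> form a
  matrix having the vector of generators as eigenvector for \<open>x\<close>; this vector is nonzero
  because of \<open>s\<^sub>0\<close>. So \<open>x\<close> is a root of a monic integer
  characteristic polynomial. The generators may be linearly dependent.\<close>

lemma algebraic_int_if_stabilizes:
  fixes x :: complex
  assumes "finite S" and "s\<^sub>0 \<in> S" "s\<^sub>0 \<noteq> 0"
    and stable: "\<And>s. s \<in> S \<Longrightarrow> x * s \<in> int_module.span S"
  shows "algebraic_int x"
proof -
  obtain xs where xs: "set xs = S" "distinct xs"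
    using finite_distinct_list[OF \<open>finite S\<close>] by blast
  define n where "n = length xs"
  have "\<exists>c. x * s = (\<Sum>t\<in>S. of_int (c t) * t)" if "s \<in> S" for s
    using stable[OF that] by (auto simp: int_module.span_finite[OF \<open>finite S\<close>])
  then obtain c where c: "x * s = (\<Sum>t\<in>S. of_int (c s t) * t)" if "s \<in> S" for s
    by metis
  define A where "A = mat n n (\<lambda>(i, j). c (xs ! i) (xs ! j))"
  define B :: "complex mat" where "B = map_mat of_int A"
  have A: "A \<in> carrier_mat n n" and B: "B \<in> carrier_mat n n"
    by (auto simp: A_def B_def)
  have sum_S: "(\<Sum>t\<in>S. F t) = (\<Sum>j<n. F (xs ! j))" for F :: "complex \<Rightarrow> complex"
    using sum.reindex_bij_betw[OF bij_betw_nth[OF xs(2) refl refl], of F] xs(1)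
    by (simp add: n_def)
  define v where "v = vec n (\<lambda>i. xs ! i)"
  have "eigenvector B v x"
    unfolding eigenvector_def
  proof (intro conjI)
    show "v \<in> carrier_vec (dim_row B)" using B by (simp add: v_def)
    obtain i where "i < n" "xs ! i = s\<^sub>0"
      using \<open>s\<^sub>0 \<in> S\<close> xs(1) by (metis in_set_conv_nth n_def)
    then show "v \<noteq> 0\<^sub>v (dim_row B)"
      using B \<open>s\<^sub>0 \<noteq> 0\<close> by (auto simp: v_def dest!: arg_cong[where f = "\<lambda>v. vec_index v i"])
    show "B *\<^sub>v v = x \<cdot>\<^sub>v v"
    proof (rule eq_vecI)
      fix i assume "i < dim_vec (x \<cdot>\<^sub>v v)"
      then have i: "i < n" by (simp add: v_def)
      then have "xs ! i \<in> S" using xs(1) n_def by auto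
      from c[OF this] show "(B *\<^sub>v v) $ i = (x \<cdot>\<^sub>v v) $ i"
        using i B by (simp add: v_def scalar_prod_def sum_S B_def A_def lessThan_atLeast0)
    qed (use B in \<open>simp add: v_def\<close>)
  qed
  then have "poly (char_poly B) x = 0"
    using eigenvalue_root_char_poly[OF B] by (auto simp: eigenvalue_def)
  moreover have "char_poly B = map_poly of_int (char_poly A)"
    unfolding B_def by (rule of_int_hom.char_poly_hom[OF A])
  ultimately show ?thesis
    using degree_monic_char_poly[OF A] by (auto simp: algebraic_int_altdef_ipoly)
qed

lemma span_int_mult:
  assumes "\<And>s. s \<in> S \<Longrightarrow> x * s \<in> int_module.span T" and "y \<in> int_module.span S"
  shows "x * y \<in> int_module.span T"
  using assms(2)
proof (induction rule: int_module.span_induct_alt)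
  case base
  then show ?case by (simp add: int_module.span_zero)
next
  case (step c s y)
  have "x * (of_int c * s + y) = of_int c * (x * s) + x * y"
    by (simp add: algebra_simps)
  then show ?case
    using step assms(1) by (metis int_module.span_add int_module.span_scale)
qed

text \<open>The monic equation rewrites \<open>x ^ d\<close> by lower powers, so the span of the
  first \<open>d\<close> powers is stable under \<open>x\<close>. The bound \<open>d > 0\<close>
  puts 1 among the generators, which later yields the nonzero element for the determinant
  trick.\<close>

lemma power_in_span_powers:
  fixes x :: complex
  assumes "algebraic_int x"
  obtains d where "d > 0" "\<And>i. x ^ i \<in> int_module.span ((\<lambda>i. x ^ i) ` {..<d})"
proof -
  obtain P :: "int poly" where P: "ev P x = 0" "lead_coeff P = 1"
    using assms by (auto simp: algebraic_int_altdef_ipoly)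
  define d where "d = degree P"
  have "d > 0"
    using P by (metis d_def degree_0_id ev_simps(6) gr0I of_int_1 one_neq_zero)
  let ?V = "int_module.span ((\<lambda>i. x ^ i) ` {..<d})"
  have low: "x ^ i \<in> ?V" if "i < d" for i
    using that by (auto intro: int_module.span_base)
  have "(\<Sum>i<d. of_int (coeff P i) * x ^ i) + x ^ d = 0"
    using P by (simp add: poly_altdef d_def lessThan_Suc_atMost[symmetric] of_int_hom.coeff_map_poly_hom)
  then have "x ^ d = (\<Sum>i<d. of_int (- coeff P i) * x ^ i)"
    by (simp add: sum_negf eq_neg_iff_add_eq_0 add.commute)
  also have "\<dots> \<in> ?V"
    by (intro int_module.span_sum int_module.span_scale low) auto
  finally have top: "x ^ d \<in> ?V" .
  have "x ^ i \<in> ?V" for i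
  proof (induction i)
    case 0
    then show ?case using low[OF \<open>d > 0\<close>] by simp
  next
    case (Suc i)
    have "x * s \<in> ?V" if "s \<in> (\<lambda>i. x ^ i) ` {..<d}" for s
      using that low top by (auto simp flip: power_Suc) (metis Suc_lessI)
    from span_int_mult[OF this Suc] show ?case by simp
  qed
  with \<open>d > 0\<close> that show ?thesis by blast
qed

lemma ev_in_span:
  assumes "\<And>i. x ^ i * s \<in> int_module.span S"
  shows "ev h x * s \<in> int_module.span S"
proof -
  have "ev h x * s = (\<Sum>i\<le>degree h. of_int (coeff h i) * (x ^ i * s))"
    by (simp add: poly_altdef sum_distrib_right mult.assoc of_int_hom.coeff_map_poly_hom)
  then show ?thesis
    using assms by (auto intro!: int_module.span_sum int_module.span_scale)
qed

text \<open>The products \<open>x ^ i * y ^ j\<close> with bounded exponents generate a lattice that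
  contains 1 and is stable under \<open>x\<close> and \<open>y\<close>, hence under their sum and
  product.\<close>

lemma
  fixes x y :: complex
  assumes "algebraic_int x" "algebraic_int y"
  shows algebraic_int_plus: "algebraic_int (x + y)"
    and algebraic_int_times: "algebraic_int (x * y)"
proof -
  obtain d where d: "d > 0" "\<And>i. x ^ i \<in> int_module.span ((\<lambda>i. x ^ i) ` {..<d})"
    using power_in_span_powers[OF assms(1)] by blast
  obtain e where e: "e > 0" "\<And>i. y ^ i \<in> int_module.span ((\<lambda>i. y ^ i) ` {..<e})"
    using power_in_span_powers[OF assms(2)] by blast
  define S where "S = (\<lambda>(i, j). x ^ i * y ^ j) ` ({..<d} \<times> {..<e})"
  have "finite S" "1 \<in> S"
    using d(1) e(1) by (auto simp: S_def image_iff intro!: bexI[of _ 0])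
  have low: "y ^ j * x ^ i \<in> int_module.span S" if "j < e" for i j
  proof (rule span_int_mult[OF _ d(2)])
    show "y ^ j * s \<in> int_module.span S" if "s \<in> (\<lambda>i. x ^ i) ` {..<d}" for s
      using that \<open>j < e\<close> by (intro int_module.span_base) (force simp: S_def mult.commute)
  qed
  have all: "x ^ i * y ^ j \<in> int_module.span S" for i j
    by (rule span_int_mult[OF _ e(2)]) (use low in \<open>auto simp: mult.commute\<close>)
  have "x * s \<in> int_module.span S" "y * s \<in> int_module.span S" if "s \<in> S" for s
    using that all[of "Suc _" _] all[of _ "Suc _"] by (auto simp: S_def mult_ac)
  note stable = this
  have "(x + y) * s \<in> int_module.span S" "x * y * s \<in> int_module.span S" if "s \<in> S" for s
    using that stable int_module.span_add span_int_mult[of S x S, OF stable(1)]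
    by (auto simp: distrib_right mult.assoc)
  then show "algebraic_int (x + y)" "algebraic_int (x * y)"
    using algebraic_int_if_stabilizes[OF \<open>finite S\<close> \<open>1 \<in> S\<close>] by auto
qed

lemma algebraic_int_ev:
  assumes "algebraic_int x"
  shows "algebraic_int (ev h x)"
proof (induction h)
  case (pCons c h)
  have "algebraic_int (complex_of_int c)"
    by (rule int_imp_algebraic_int) simp
  then show ?case
    using pCons assms by (simp add: ev_simps algebraic_int_plus algebraic_int_times)
qed simp

text \<open>The hypotheses say that multiplication by \<open>\<theta>\<close> stabilises the lattice
  \<open>u \<cdot> \<int>[x] + v \<cdot> \<int>[x]\<close>.\<close>
lemma algebraic_int_if_stabilizes_ideal:
  fixes x \<theta> :: complex
  assumes "algebraic_int x" and "u \<noteq> 0"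
    and "\<theta> * u = ev A x * u + ev B x * v" and "\<theta> * v = ev C x * u + ev D x * v"
  shows "algebraic_int \<theta>"
proof -
  obtain d where d: "d > 0" "\<And>i. x ^ i \<in> int_module.span ((\<lambda>i. x ^ i) ` {..<d})"
    using power_in_span_powers[OF assms(1)] by blast
  define S where "S = (\<lambda>i. u * x ^ i) ` {..<d} \<union> (\<lambda>i. v * x ^ i) ` {..<d}"
  have S: "finite S" "u \<in> S"
    using d(1) by (auto simp: S_def image_iff intro!: bexI[of _ 0])
  have u: "u * x ^ i \<in> int_module.span S" and v: "v * x ^ i \<in> int_module.span S" for i
    by (rule span_int_mult[OF _ d(2)]; auto simp: S_def intro!: int_module.span_base)+
  have uv: "ev h x * (u * x ^ i) \<in> int_module.span S" "ev h x * (v * x ^ i) \<in> int_module.span S" for h i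
    by (rule ev_in_span; use u[of "_ + i"] v[of "_ + i"] in \<open>simp add: power_add mult_ac\<close>)+
  have "\<theta> * s \<in> int_module.span S" if "s \<in> S" for s
  proof -
    from that obtain i where "s = u * x ^ i \<or> s = v * x ^ i" by (auto simp: S_def)
    then have "\<theta> * s = ev A x * (u * x ^ i) + ev B x * (v * x ^ i) \<or>
        \<theta> * s = ev C x * (u * x ^ i) + ev D x * (v * x ^ i)"
      using assms(3,4) by (metis distrib_right mult.assoc)
    then show ?thesis using uv by (metis int_module.span_add)
  qed
  then show ?thesis using algebraic_int_if_stabilizes[OF S \<open>u \<noteq> 0\<close>] by blast
qed

section \<open>Ideals of integer polynomials\<close>

text \<open>For Z[X] as a module over itself, subspaces are ideals and \<open>span\<close> is the
  generated ideal.\<close>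

interpretation poly_ideal: Modules.module "(*) :: int poly \<Rightarrow> int poly \<Rightarrow> int poly"
  by unfold_locales (auto simp: algebra_simps)

declare poly_ideal.scale_scale [simp del]

lemma monic_division:
  fixes g h :: "int poly"
  assumes "lead_coeff g = 1"
  obtains s r where "h = g * s + r" "r = 0 \<or> degree r < degree g"
proof -
  obtain s r where sr: "pseudo_divmod h g = (s, r)" by fastforce
  have "g \<noteq> 0" using assms by auto
  from pseudo_divmod[OF this sr] assms that show ?thesis by auto
qed

text \<open>\<open>W = 0\<close> would give \<open>g = r\<close>, of degree below that of
  \<open>U\<close>. Otherwise \<open>r\<close> cannot reach the leading term of
  \<open>U * W\<close>, which is therefore that of \<open>g\<close>.\<close>

lemma monic_factor_degree:
  fixes g U W r :: "int poly"
  assumes "lead_coeff g = 1" "lead_coeff U = 1" "g = U * W + r" "r = 0 \<or> degree r < degree U"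
    "degree U \<le> degree g"
  shows "lead_coeff W = 1" "degree g = degree U + degree W"
proof -
  have U: "U \<noteq> 0" using assms(2) by auto
  have W: "W \<noteq> 0"
  proof
    assume "W = 0"
    then have "g = r" using assms(3) by simp
    then show False using assms(1,4,5) by auto
  qed
  have "degree r < degree (U * W) \<or> r = 0"
    using assms(4) U W by (auto simp: degree_mult_eq)
  then have "degree g = degree (U * W) \<and> lead_coeff g = lead_coeff (U * W)"
    unfolding assms(3) by (auto simp: degree_add_eq_left lead_coeff_add_le coeff_eq_0)
  then show "lead_coeff W = 1" "degree g = degree U + degree W"
    using assms(1,2) U W lead_coeff_mult[of U W] by (auto simp: degree_mult_eq)
qed

lemma ideal_const_span:
  "h \<in> poly_ideal.span {[:q:], \<pi>} \<longleftrightarrow> (\<exists>s t. h = \<pi> * s + [:q:] * t)"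
proof -
  have "h \<in> poly_ideal.span {[:q:], \<pi>} \<longleftrightarrow> (\<exists>t s. h - t * [:q:] = s * \<pi>)"
    by (simp add: poly_ideal.span_insert poly_ideal.span_singleton image_iff)
  also have "\<dots> \<longleftrightarrow> (\<exists>s t. h = \<pi> * s + [:q:] * t)"
    by (metis add.commute diff_eq_eq mult.commute)
  finally show ?thesis .
qed

text \<open>Descent on the degree bound \<open>m\<close>: a top coefficient divisible by
  \<open>q\<close> is removed by subtracting a multiple of \<open>q\<close>; any other one would
  yield a monic element of \<open>J\<close> of degree below \<open>degree U\<close>.\<close>

lemma ideal_low_degree_dvd:
  fixes q :: int
  assumes "prime q" and J: "poly_ideal.subspace J" "[:q:] \<in> J"
    and U: "\<And>h. h \<in> J \<Longrightarrow> lead_coeff h = 1 \<Longrightarrow> degree U \<le> degree h"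
    and "r \<in> J" "\<And>i. i \<ge> m \<Longrightarrow> coeff r i = 0" "m \<le> degree U"
  shows "[:q:] dvd r"
  using assms(5-7)
proof (induction m arbitrary: r)
  case 0
  then have "r = 0" by (simp add: poly_eq_iff)
  then show ?case by simp
next
  case (Suc m)
  have mult_J: "k * h \<in> J" if "h \<in> J" for h k
    using that J poly_ideal.subspace_scale by blast
  show ?case
  proof (cases "q dvd coeff r m")
    case True
    then obtain c where c: "coeff r m = q * c" by blast
    have "r - monom c m * [:q:] \<in> J"
      using Suc.prems J mult_J by (intro poly_ideal.subspace_diff)
    moreover have "coeff (r - monom c m * [:q:]) i = 0" if "i \<ge> m" for i
      using that Suc.prems(2) c by (cases "i = m") (auto simp: mult.commute)
    ultimately have "[:q:] dvd r - monom c m * [:q:]"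
      using Suc by simp
    then show ?thesis
      by (metis dvd_add dvd_triv_right diff_add_cancel)
  next
    case False
    then have "coprime q (coeff r m)"
      using \<open>prime q\<close> by (simp add: prime_imp_coprime)
    then obtain u v where uv: "u * coeff r m + v * q = 1"
      by (metis add.commute bezout_int coprime_iff_gcd_eq_1)
    \<comment> \<open>The Bezout combination makes the coefficient at \<open>m\<close> equal to 1,
      so \<open>T\<close> is monic of degree \<open>m\<close>.\<close>
    define T where "T = [:u:] * r + monom v m * [:q:]"
    have "T \<in> J"
      unfolding T_def using Suc.prems J mult_J by (intro poly_ideal.subspace_add)
    have above: "coeff T i = 0" if "i > m" for i
      using that Suc.prems(2)[of i] by (simp add: T_def)
    moreover have at: "coeff T m = 1" using uv by (simp add: T_def mult.commute)
    ultimately have "degree T = m"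
      by (metis (no_types, lifting) le_degree leading_coeff_0_iff less_le not_less zero_neq_one coeff_0)
    then show ?thesis
      using U[OF \<open>T \<in> J\<close>] at Suc.prems(3) by simp
  qed
qed

text \<open>Let \<open>U\<close> be monic of least degree in \<open>J\<close>. Remainders modulo
  \<open>U\<close> stay in \<open>J\<close> and have lower degree, so \<open>q\<close> divides them,
  whence \<open>J = (q, U)\<close>. The degree bound on \<open>[:q:] * t\<close> is recorded for
  \<open>monic_factor_degree\<close>.\<close>

lemma ideal_monic_generator:
  fixes q :: int
  assumes "prime q" and J: "poly_ideal.subspace J" "[:q:] \<in> J" and g: "g \<in> J" "lead_coeff g = 1"
  obtains U where "U \<in> J" "lead_coeff U = 1" "degree U \<le> degree g"
    "\<And>h. h \<in> J \<Longrightarrow> \<exists>s t. h = U * s + [:q:] * t \<and> ([:q:] * t = 0 \<or> degree ([:q:] * t) < degree U)"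
proof -
  obtain U where "U \<in> J \<and> lead_coeff U = 1"
    and min: "\<forall>h. h \<in> J \<and> lead_coeff h = 1 \<longrightarrow> degree U \<le> degree h"
    using ex_has_least_nat[of "\<lambda>h. h \<in> J \<and> lead_coeff h = 1" g degree] g by blast
  then have U: "U \<in> J" "lead_coeff U = 1"
    and least: "\<And>h. h \<in> J \<Longrightarrow> lead_coeff h = 1 \<Longrightarrow> degree U \<le> degree h"
    by auto
  show thesis
  proof (rule that[OF U least[OF g]])
    fix h assume "h \<in> J"
    obtain s r where sr: "h = U * s + r" "r = 0 \<or> degree r < degree U"
      using monic_division[OF U(2)] by blast
    have "r = h - s * U" using sr by (simp add: mult.commute)
    then have "r \<in> J"
      using \<open>h \<in> J\<close> U J poly_ideal.subspace_diff poly_ideal.subspace_scale by metis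
    have "[:q:] dvd r"
    proof (cases "r = 0")
      case False
      then show ?thesis
        using sr ideal_low_degree_dvd[OF assms(1) J least \<open>r \<in> J\<close>, of "degree U"]
        by (auto simp: coeff_eq_0)
    qed simp
    then obtain t where t: "r = [:q:] * t" by blast
    show "\<exists>s t. h = U * s + [:q:] * t \<and> ([:q:] * t = 0 \<or> degree ([:q:] * t) < degree U)"
      using sr unfolding t by blast
  qed
qed

section \<open>Maximal ideals (q, pi) of Z[X] and their squares\<close>

text \<open>Maximality is expressed as invertibility modulo the ideal; properness follows in
  \<open>one_notin_M\<close> from the positive degree of the monic \<open>\<pi>\<close>.\<close>

locale max_ideal =
  fixes q :: int and \<pi> :: "int poly"
  assumes prime_q: "prime q" and monic: "lead_coeff \<pi> = 1" and degree_pos: "degree \<pi> > 0"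
    and inverse_mod: "A \<notin> poly_ideal.span {[:q:], \<pi>} \<Longrightarrow>
      \<exists>B. 1 - B * A \<in> poly_ideal.span {[:q:], \<pi>}"
begin

abbreviation "M \<equiv> poly_ideal.span {[:q:], \<pi>}"

lemma M_add: "A \<in> M \<Longrightarrow> B \<in> M \<Longrightarrow> A + B \<in> M"
  by (rule poly_ideal.span_add)

lemma M_diff: "A \<in> M \<Longrightarrow> B \<in> M \<Longrightarrow> A - B \<in> M"
  by (rule poly_ideal.span_diff)

lemma M_mult_left: "A \<in> M \<Longrightarrow> B * A \<in> M"
  by (rule poly_ideal.span_scale)

lemma M_mult_right: "A \<in> M \<Longrightarrow> A * B \<in> M"
  using M_mult_left by (simp add: mult.commute)

lemma q_in_M: "[:q:] \<in> M" and pi_in_M: "\<pi> \<in> M"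
  by (auto intro: poly_ideal.span_base)

text \<open>After reduction of \<open>t\<close> modulo \<open>\<pi>\<close>, the polynomial
  \<open>[:c:] - [:q:] * r\<close> is a multiple of \<open>\<pi>\<close> of smaller degree, hence
  zero. So \<open>M\<close> meets the integers exactly in the multiples of \<open>q\<close>.\<close>

lemma const_in_M_iff: "[:c:] \<in> M \<longleftrightarrow> q dvd c"
proof
  assume "[:c:] \<in> M"
  then obtain s t where st: "[:c:] = \<pi> * s + [:q:] * t"
    by (auto simp: ideal_const_span)
  obtain s' r where s': "t = \<pi> * s' + r" "r = 0 \<or> degree r < degree \<pi>"
    using monic_division[OF monic] by blast
  have eq: "[:c:] - [:q:] * r = \<pi> * (s + [:q:] * s')"
    by (simp add: st s' algebra_simps)
  have "degree ([:c:] - [:q:] * r) < degree \<pi>"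
    using s'(2) degree_pos by (intro degree_diff_less) auto
  then have "s + [:q:] * s' = 0"
    unfolding eq using monic by (metis add_lessD1 degree_mult_eq leading_coeff_0_iff less_irrefl zero_neq_one)
  then have "[:c:] = [:q:] * r" using eq by simp
  then have "c = q * coeff r 0"
    by (metis coeff_pCons_0 mult_pCons_left add_0_right coeff_smult pCons_0_0 mult_zero_left)
  then show "q dvd c" by simp
next
  assume "q dvd c"
  then obtain k where "c = k * q" by (metis dvdE mult.commute)
  then have "[:c:] = [:k:] * [:q:]" by simp
  then show "[:c:] \<in> M" using M_mult_left[OF q_in_M] by metis
qed

lemma one_notin_M: "1 \<notin> M"
  using const_in_M_iff[of 1] prime_q by (metis not_prime_unit one_pCons)

lemma M_prime: "A * B \<in> M \<Longrightarrow> A \<in> M \<or> B \<in> M"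
proof (rule ccontr)
  assume AB: "A * B \<in> M" and "\<not> (A \<in> M \<or> B \<in> M)"
  then obtain C where C: "1 - C * A \<in> M" and B: "B \<notin> M" using inverse_mod by blast
  have "B = B * (1 - C * A) + C * (A * B)" by (simp add: algebra_simps)
  then show False using AB B C M_add M_mult_left by metis
qed

lemma M_power: "A ^ n \<in> M \<Longrightarrow> A \<in> M"
  by (induction n) (use one_notin_M M_prime in auto)

lemma M_prod: "finite I \<Longrightarrow> (\<Prod>i\<in>I. A i) \<in> M \<Longrightarrow> \<exists>i\<in>I. A i \<in> M"
  by (induction I rule: finite_induct) (use one_notin_M M_prime in auto)

text \<open>The square of the ideal \<open>M\<close>, written out through the products of its two
  generators.\<close>

definition M2 :: "int poly set" where
  "M2 = {h. \<exists>A B C. h = [:q:] * [:q:] * A + [:q:] * \<pi> * B + \<pi> * \<pi> * C}"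

lemma mult_in_M2: "A \<in> M \<Longrightarrow> B \<in> M \<Longrightarrow> A * B \<in> M2"
proof -
  assume "A \<in> M" "B \<in> M"
  then obtain s t s' t' where "A = \<pi> * s + [:q:] * t" "B = \<pi> * s' + [:q:] * t'"
    by (auto simp: ideal_const_span)
  then have "A * B = [:q:] * [:q:] * (t * t') + [:q:] * \<pi> * (s * t' + s' * t) + \<pi> * \<pi> * (s * s')"
    by (simp only: distrib_left distrib_right ac_simps)
  then show ?thesis unfolding M2_def by blast
qed

lemma M2_add: "A \<in> M2 \<Longrightarrow> B \<in> M2 \<Longrightarrow> A + B \<in> M2"
  unfolding M2_def
proof clarify
  fix A B C A' B' C'
  show "\<exists>Aa Ba Ca. [:q:] * [:q:] * A + [:q:] * \<pi> * B + \<pi> * \<pi> * C +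
      ([:q:] * [:q:] * A' + [:q:] * \<pi> * B' + \<pi> * \<pi> * C') =
      [:q:] * [:q:] * Aa + [:q:] * \<pi> * Ba + \<pi> * \<pi> * Ca"
    by (rule exI[of _ "A + A'"], rule exI[of _ "B + B'"], rule exI[of _ "C + C'"])
       (simp only: distrib_left distrib_right ac_simps)
qed

lemma M2_mult_left: "A \<in> M2 \<Longrightarrow> B * A \<in> M2"
  unfolding M2_def
proof clarify
  fix A' B' C'
  show "\<exists>Aa Ba Ca. B * ([:q:] * [:q:] * A' + [:q:] * \<pi> * B' + \<pi> * \<pi> * C') =
      [:q:] * [:q:] * Aa + [:q:] * \<pi> * Ba + \<pi> * \<pi> * Ca"
    by (rule exI[of _ "B * A'"], rule exI[of _ "B * B'"], rule exI[of _ "B * C'"])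
       (simp only: distrib_left ac_simps)
qed

text \<open>The constant \<open>q\<close> is prime in Z[X] and does not divide the monic
  \<open>\<pi>\<close>, so it divides the cofactor of \<open>\<pi> * \<pi>\<close> and cancels
  throughout. For constants this says that an integer in the square of \<open>M\<close> is divisible
  by the square of \<open>q\<close>.\<close>

lemma M2_cancel_q: "[:q:] * x \<in> M2 \<Longrightarrow> x \<in> M"
proof -
  assume "[:q:] * x \<in> M2"
  then obtain A B C where eq: "[:q:] * x = [:q:] * [:q:] * A + [:q:] * \<pi> * B + \<pi> * \<pi> * C"
    by (auto simp: M2_def)
  have "\<pi> * \<pi> * C = [:q:] * (x - [:q:] * A - \<pi> * B)"
    unfolding right_diff_distrib eq by (simp only: mult.assoc add_diff_cancel_left' add.assoc diff_diff_eq) 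
  then have "[:q:] dvd \<pi> * \<pi> * C" by (metis dvd_triv_left)
  moreover have "prime_elem [:q:]"
    using prime_q by (simp add: prime_elem_const_poly_iff prime_elem_iff_prime_abs prime_ge_0_int)
  moreover have "\<not> [:q:] dvd \<pi>"
    using monic prime_q by (metis const_poly_dvd_iff not_prime_unit)
  ultimately obtain C' where "C = [:q:] * C'"
    by (metis dvdE prime_elem_dvd_mult_iff)
  then have "[:q:] * x = [:q:] * ([:q:] * A + \<pi> * B + \<pi> * \<pi> * C')"
    unfolding eq by (simp only: distrib_left ac_simps)
  moreover have "[:q:] \<noteq> 0" using prime_q by auto
  ultimately have "x = [:q:] * A + \<pi> * B + \<pi> * \<pi> * C'" by (metis mult_left_cancel)
  then show ?thesis
    using M_add M_mult_right[OF q_in_M] M_mult_right[OF pi_in_M] by (simp only: mult.assoc)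
qed

end

text \<open>Take \<open>\<pi>\<close> monic of least positive degree with \<open>W\<close> in
  \<open>(q, \<pi>)\<close>. Adjoining an outside element \<open>A\<close> gives an ideal
  \<open>(q, U)\<close>. If \<open>U\<close> were non-constant, minimality would make this the old
  ideal; so \<open>U = 1\<close>, which is the required inverse.\<close>

lemma exists_max_ideal:
  fixes q :: int
  assumes "prime q" "lead_coeff W = 1" "degree W > 0"
  obtains \<pi> where "max_ideal q \<pi>" "W \<in> poly_ideal.span {[:q:], \<pi>}"
proof -
  define Q where "Q \<pi> \<longleftrightarrow> lead_coeff \<pi> = 1 \<and> degree \<pi> > 0 \<and> W \<in> poly_ideal.span {[:q:], \<pi>}" for \<pi>
  have "Q W" using assms by (auto simp: Q_def intro: poly_ideal.span_base)
  then obtain \<pi> where \<pi>: "Q \<pi>" and least: "\<And>h. Q h \<Longrightarrow> degree \<pi> \<le> degree h"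
    using ex_has_least_nat[of Q W degree] by blast
  let ?M = "poly_ideal.span {[:q:], \<pi>}"
  have inv: "\<exists>B. 1 - B * A \<in> ?M" if A: "A \<notin> ?M" for A
  proof -
    let ?L = "poly_ideal.span {A, [:q:], \<pi>}"
    have L: "poly_ideal.subspace ?L" "[:q:] \<in> ?L" "\<pi> \<in> ?L" "A \<in> ?L"
      by (auto intro: poly_ideal.span_base)
    obtain U where U: "U \<in> ?L" "lead_coeff U = 1" "degree U \<le> degree \<pi>"
      "\<And>h. h \<in> ?L \<Longrightarrow> \<exists>s t. h = U * s + [:q:] * t \<and> ([:q:] * t = 0 \<or> degree ([:q:] * t) < degree U)"
      using ideal_monic_generator[OF assms(1) L(1,2,3)] \<pi> by (auto simp: Q_def)
    have L_sub: "?L \<subseteq> poly_ideal.span {[:q:], U}"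
    proof
      fix h assume "h \<in> ?L"
      then obtain s t where "h = U * s + [:q:] * t" using U(4) by blast
      then show "h \<in> poly_ideal.span {[:q:], U}" unfolding ideal_const_span by blast
    qed
    have "degree U = 0"
    proof (rule ccontr)
      assume "degree U \<noteq> 0"
      have "?M \<subseteq> poly_ideal.span {[:q:], U}"
        using L_sub L by (intro poly_ideal.span_minimal) auto
      then have "Q U" using \<open>degree U \<noteq> 0\<close> U \<pi> by (auto simp: Q_def)
      with least have "degree \<pi> \<le> degree U" by blast
      with U(3) have deg: "degree \<pi> = degree U" by simp
      obtain s t where st: "\<pi> = U * s + [:q:] * t" "[:q:] * t = 0 \<or> degree ([:q:] * t) < degree U"
        using U(4)[OF L(3)] by blast
      \<comment> \<open>Equal degrees force the cofactor to be 1, so \<open>\<pi>\<close> and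
        \<open>U\<close> agree modulo \<open>q\<close> and generate the same ideal with it.\<close>
      have "lead_coeff s = 1" "degree s = 0"
        using monic_factor_degree[OF _ U(2) st U(3)] \<pi> deg by (auto simp: Q_def)
      then have "s = 1" by (metis degree_eq_zeroE lead_coeff_pCons(2) one_pCons pCons_eq_0_iff degree_0_id)
      then have "U = \<pi> - t * [:q:]" using st by (simp add: mult.commute)
      moreover have "\<pi> - t * [:q:] \<in> ?M"
        by (intro poly_ideal.span_diff poly_ideal.span_scale poly_ideal.span_base) auto
      ultimately have "U \<in> ?M" by simp
      then have "poly_ideal.span {[:q:], U} \<subseteq> ?M"
        by (intro poly_ideal.span_minimal) (auto intro: poly_ideal.span_base)
      then show False using A L L_sub by blast
    qed
    then have "U = 1" using U(2) by (metis degree_0_id of_int_hom.hom_one one_pCons)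
    then show ?thesis
      using U(1) unfolding poly_ideal.span_insert[of A] by auto
  qed
  have "max_ideal q \<pi>"
    using assms(1) \<pi> inv by unfold_locales (auto simp: Q_def)
  then show ?thesis using that \<pi> by (auto simp: Q_def)
qed

section \<open>Dedekind's criterion\<close>

text \<open>Pseudo-division by an integer polynomial \<open>m\<close> of least degree vanishing at
  \<open>x\<close> shows that \<open>m\<close> divides a nonzero constant multiple of every
  polynomial vanishing at \<open>x\<close>. Irreducible elements of Z[X] are prime, so
  \<open>g\<close> divides first \<open>m\<close> and then \<open>h\<close>, since it divides no
  nonzero constant.\<close>

lemma min_poly_dvd:
  fixes g h :: "int poly"
  assumes "irreducible g" "lead_coeff g = 1" "ev g x = 0" "ev h x = 0"
  shows "g dvd h"
proof -
  define Q where "Q m \<longleftrightarrow> m \<noteq> 0 \<and> ev m x = 0" for m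
  have prime: "prime_elem g"
    using assms(1) by (rule irreducible_imp_prime_elem)
  have "Q g" using assms by (auto simp: Q_def)
  then obtain m where m: "Q m" and least: "\<And>k. Q k \<Longrightarrow> degree m \<le> degree k"
    using ex_has_least_nat[of Q g degree] by blast
  have dvd: "\<exists>c s. c \<noteq> 0 \<and> [:c:] * k = m * s" if "ev k x = 0" for k
  proof -
    obtain s r where sr: "pseudo_divmod k m = (s, r)" by fastforce
    have "m \<noteq> 0" using m by (simp add: Q_def)
    define c where "c = lead_coeff m ^ (Suc (degree k) - degree m)"
    have eq: "smult c k = m * s + r" and deg: "r = 0 \<or> degree r < degree m"
      using pseudo_divmod[OF \<open>m \<noteq> 0\<close> sr] by (auto simp: c_def)
    have "ev r x = 0"
      using arg_cong[OF eq, of "\<lambda>h. ev h x"] that m by (simp add: ev_simps Q_def)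
    then have "r = 0" using deg least[of r] by (fastforce simp: Q_def)
    moreover have "c \<noteq> 0" using \<open>m \<noteq> 0\<close> by (simp add: c_def)
    ultimately show ?thesis using eq by auto
  qed
  have not_dvd_const: "\<not> g dvd [:c:]" if "c \<noteq> 0" for c
  proof
    assume "g dvd [:c:]"
    then have "degree g = 0"
      using dvd_imp_degree_le[of g "[:c:]"] that by simp
    then have "g = 1" using assms(2) by (metis degree_0_id of_int_hom.hom_one one_pCons)
    then show False using assms(3) by simp
  qed
  have "g dvd m"
  proof -
    obtain c s where cs: "c \<noteq> 0" "[:c:] * g = m * s" using dvd[OF assms(3)] by blast
    then have "g dvd m * s" by (metis dvd_triv_right)
    then consider "g dvd m" | "g dvd s" using prime by (metis prime_elem_dvd_mult_iff)
    then show ?thesis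
    proof cases
      case 2
      then obtain t where "s = g * t" by blast
      then have "g * [:c:] = g * (m * t)" using cs by (simp only: ac_simps)
      then have "[:c:] = m * t" using prime by (metis mult_left_cancel prime_elem_def)
      then have "degree m = 0" using cs(1)
        by (metis add_is_0 degree_mult_eq degree_pCons_0 mult_eq_0_iff pCons_eq_0_iff)
      then obtain b where "m = [:b:]" by (metis degree_0_id)
      then show ?thesis using m by (auto simp: Q_def ev_simps)
    qed
  qed
  obtain c s where cs: "c \<noteq> 0" "[:c:] * h = m * s" using dvd[OF assms(4)] by blast
  then have "g dvd [:c:] * h" using \<open>g dvd m\<close> by simp
  then show ?thesis using not_dvd_const[OF cs(1)] prime by (metis prime_elem_dvd_mult_iff)
qed

text \<open>Multiplying the monic equation of \<open>\<theta>\<close> by a power of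
  \<open>Z(x)\<close> clears denominators, and divisibility by \<open>g\<close> lifts the relation
  to Z[X]. Consequently a prime ideal containing \<open>Z\<close> and \<open>g\<close> also contains
  \<open>Y\<close>.\<close>

lemma algebraic_int_quotient_power:
  assumes "irreducible g" "lead_coeff g = 1" "ev g x = 0"
    and "algebraic_int \<theta>" "\<theta> * ev Z x = ev Y x"
  obtains k R T where "Y ^ k = Z * R + g * T"
proof -
  obtain P :: "int poly" where P: "ev P \<theta> = 0" "lead_coeff P = 1"
    using assms(4) by (auto simp: algebraic_int_altdef_ipoly)
  define k where "k = degree P"
  define z where "z = ev Z x"
  define R where "R = - (\<Sum>i<k. [:coeff P i:] * Y ^ i * Z ^ (k - 1 - i))"
  have ev_sum: "ev (\<Sum>i<k. F i) x = (\<Sum>i<k. ev (F i) x)" for F :: "nat \<Rightarrow> int poly"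
    by (induction k) (auto simp: ev_simps)
  have "(\<Sum>i<k. of_int (coeff P i) * \<theta> ^ i) + \<theta> ^ k = 0"
    using P by (simp add: poly_altdef k_def lessThan_Suc_atMost[symmetric] of_int_hom.coeff_map_poly_hom)
  then have "0 = ((\<Sum>i<k. of_int (coeff P i) * \<theta> ^ i) + \<theta> ^ k) * z ^ k" by simp
  also have "\<dots> = (\<Sum>i<k. of_int (coeff P i) * \<theta> ^ i * z ^ k) + (\<theta> * z) ^ k"
    by (simp add: distrib_right sum_distrib_right power_mult_distrib)
  \<comment> \<open>Since \<open>i < k\<close>, a factor \<open>z\<close> remains after
    \<open>i\<close> factors are absorbed into \<open>\<theta> * z\<close>; it becomes the factor
    \<open>Z\<close> of the result.\<close>
  also have "(\<Sum>i<k. of_int (coeff P i) * \<theta> ^ i * z ^ k) =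
      (\<Sum>i<k. z * (of_int (coeff P i) * (\<theta> * z) ^ i * z ^ (k - 1 - i)))"
  proof (rule sum.cong)
    fix i assume "i \<in> {..<k}"
    then have "k = Suc (i + (k - 1 - i))" by simp
    then have "z ^ k = z * (z ^ i * z ^ (k - 1 - i))" by (metis power_Suc power_add)
    then show "of_int (coeff P i) * \<theta> ^ i * z ^ k =
        z * (of_int (coeff P i) * (\<theta> * z) ^ i * z ^ (k - 1 - i))"
      by (simp add: power_mult_distrib)
  qed simp
  also have "\<dots> = - ev (Z * R) x"
    using assms(5) by (simp add: R_def ev_simps ev_sum z_def sum_distrib_left mult_ac)
  finally have "ev (Y ^ k - Z * R) x = 0"
    using assms(5) by (simp add: ev_simps z_def)
  from min_poly_dvd[OF assms(1-3) this] obtain T where "Y ^ k - Z * R = g * T" by blast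
  then have "Y ^ k = Z * R + g * T" by (simp add: algebra_simps)
  then show ?thesis by (rule that)
qed

text \<open>One half of Dedekind's criterion. The polynomials \<open>k\<close> for which \<open>k(x) / q\<close> is integral form an
  ideal \<open>(q, U)\<close> of \<open>\<int>[X]\<close> containing \<open>g\<close>, so \<open>g = U W + q F\<close> with \<open>W\<close> non-constant. As
  \<open>\<theta> = U(x) / q\<close> is integral and \<open>\<theta> W(x) = - F(x)\<close>, powers of \<open>U\<close> and \<open>F\<close> lie in
  \<open>(q, g)\<close> and \<open>(W, g)\<close>.\<close>
lemma dedekind_non_maximal:
  fixes q :: int and x :: complex
  assumes g: "irreducible g" "lead_coeff g = 1" "ev g x = 0" and "prime q"
    and y: "algebraic_int (ev h x / of_int q)" "\<And>t. ev h x / of_int q \<noteq> ev t x"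
  obtains \<pi> U W F where "max_ideal q \<pi>" "g = U * W + [:q:] * F"
    "U \<in> poly_ideal.span {[:q:], \<pi>}" "W \<in> poly_ideal.span {[:q:], \<pi>}"
    "F \<in> poly_ideal.span {[:q:], \<pi>}"
proof -
  have q0: "(of_int q :: complex) \<noteq> 0" using \<open>prime q\<close> by auto
  have x: "algebraic_int x" using g by (auto simp: algebraic_int_altdef_ipoly)
  define J where "J = {k. algebraic_int (ev k x / of_int q)}"
  have J: "poly_ideal.subspace J"
    unfolding poly_ideal.subspace_def
  proof (intro conjI ballI allI)
    show "0 \<in> J" by (simp add: J_def)
    show "k + l \<in> J" if "k \<in> J" "l \<in> J" for k l
      using that algebraic_int_plus by (simp add: J_def ev_simps add_divide_distrib)
    show "c * k \<in> J" if "k \<in> J" for c k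
      using that algebraic_int_times[OF algebraic_int_ev[OF x, of c]]
      by (simp add: J_def ev_simps flip: times_divide_eq_right)
  qed
  have qJ: "[:q:] \<in> J" using q0 by (simp add: J_def ev_simps)
  have gJ: "g \<in> J" using g by (simp add: J_def)
  obtain U where U: "U \<in> J" "lead_coeff U = 1" "degree U \<le> degree g"
    and gen: "\<And>h. h \<in> J \<Longrightarrow> \<exists>s t. h = U * s + [:q:] * t \<and> ([:q:] * t = 0 \<or> degree ([:q:] * t) < degree U)"
    using ideal_monic_generator[OF \<open>prime q\<close> J qJ gJ g(2)] by blast
  obtain W F where WF: "g = U * W + [:q:] * F" "[:q:] * F = 0 \<or> degree ([:q:] * F) < degree U"
    using gen[OF gJ] by blast
  note W = monic_factor_degree[OF g(2) U(2) WF U(3)]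
  have ev_g: "ev U x * ev W x + of_int q * ev F x = 0"
    using g(3) unfolding WF(1) by (simp add: ev_simps del: mult_pCons_left mult_pCons_right)
  \<comment> \<open>If \<open>W = 1\<close>, then \<open>U(x) = - q F(x)\<close>, so division by
    \<open>q\<close> sends all of \<open>J\<close> into Z[x], including the given
    \<open>h\<close>.\<close>
  have "degree W > 0"
  proof (rule ccontr)
    assume "\<not> degree W > 0"
    then have "W = 1" using W(1) by (metis degree_0_id gr0I one_pCons)
    then have U_ev: "ev U x = - of_int q * ev F x"
      using ev_g by (simp add: add_eq_0_iff2)
    have "h \<in> J" using y(1) by (simp add: J_def)
    then obtain s t where "h = U * s + [:q:] * t" using gen by blast
    then have "ev h x / of_int q = ev (t - F * s) x"
      using q0 U_ev by (simp add: ev_simps field_simps del: mult_pCons_left mult_pCons_right)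
    then show False using y(2) by blast
  qed
  then obtain \<pi> where \<pi>: "max_ideal q \<pi>" "W \<in> poly_ideal.span {[:q:], \<pi>}"
    using exists_max_ideal[OF \<open>prime q\<close> W(1)] by blast
  interpret max_ideal q \<pi> by (rule \<pi>(1))
  define \<theta> where "\<theta> = ev U x / of_int q"
  have \<theta>: "algebraic_int \<theta>" using U(1) by (simp add: J_def \<theta>_def)
  have g_M: "g \<in> M"
    unfolding WF(1) using \<pi>(2) q_in_M by (intro M_add M_mult_left[OF \<pi>(2)] M_mult_right[OF q_in_M])
  have "\<theta> * ev [:q:] x = ev U x" using q0 by (simp add: \<theta>_def ev_simps)
  from algebraic_int_quotient_power[OF g \<theta> this] obtain k R T where "U ^ k = [:q:] * R + g * T" .
  then have "U ^ k \<in> M" using M_add M_mult_right q_in_M g_M by metis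
  then have "U \<in> M" by (rule M_power)
  have "\<theta> * ev W x = ev (- F) x"
    using ev_g q0 by (simp add: \<theta>_def ev_simps field_simps add_eq_0_iff)
  from algebraic_int_quotient_power[OF g \<theta> this] obtain k R T where "(- F) ^ k = W * R + g * T" .
  then have "(- F) ^ k \<in> M" using M_add M_mult_right \<pi>(2) g_M by metis
  then have "- F \<in> M" by (rule M_power)
  then have "F \<in> M" using M_mult_left[of "- F" "- 1"] by simp
  show thesis using that[OF \<pi>(1) WF(1) \<open>U \<in> M\<close> \<pi>(2) \<open>F \<in> M\<close>] .
qed

text \<open>The converse half of Dedekind's criterion: \<open>g \<in> (q, \<pi>)\<^sup>2\<close> makes \<open>(q, \<pi>)\<close>
  stable under multiplication by \<open>(\<pi> C + q B) / q\<close>.\<close>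
lemma dedekind_non_integral:
  fixes q :: int and x :: complex
  assumes g: "irreducible g" "lead_coeff g = 1" "ev g x = 0" and q: "\<bar>q\<bar> \<ge> 2"
    and eq: "g = [:q:] * [:q:] * A + [:q:] * \<pi> * B + \<pi> * \<pi> * C"
    and W: "lead_coeff (\<pi> * C + [:q:] * B) = 1" "degree (\<pi> * C + [:q:] * B) < degree g"
  defines "\<theta> \<equiv> ev (\<pi> * C + [:q:] * B) x / of_int q"
  shows "algebraic_int \<theta>" "\<theta> \<noteq> ev h x"
proof -
  have q0: "(of_int q :: complex) \<noteq> 0" using q by auto
  have x: "algebraic_int x" using g by (auto simp: algebraic_int_altdef_ipoly)
  have ev_g: "of_int q * of_int q * ev A x + of_int q * ev \<pi> x * ev B x + ev \<pi> x * ev \<pi> x * ev C x = 0"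
    using g(3) unfolding eq by (simp only: ev_simps mult_zero_right add_0_right)
  have \<theta>q: "\<theta> * of_int q = ev \<pi> x * ev C x + of_int q * ev B x"
    unfolding \<theta>_def ev_simps(1,4,6) by (rule nonzero_eq_divide_eq[THEN iffD1, OF q0 refl])
  then have "\<theta> * of_int q = ev B x * of_int q + ev C x * ev \<pi> x"
    by (simp only: ac_simps)
  moreover have "\<theta> * ev \<pi> x = ev (- A) x * of_int q + ev 0 x * ev \<pi> x"
  proof -
    have "\<theta> * ev \<pi> x * of_int q = (ev \<pi> x * ev C x + of_int q * ev B x) * ev \<pi> x"
      unfolding \<theta>q[symmetric] by (simp only: ac_simps)
    also have "\<dots> = - ev A x * of_int q * of_int q"
      using ev_g by (simp add: algebra_simps add_eq_0_iff)
    finally have "\<theta> * ev \<pi> x * of_int q = (- ev A x * of_int q) * of_int q" .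
    then show ?thesis using q0 unfolding mult_cancel_right by (simp add: ev_simps)
  qed
  ultimately show "algebraic_int \<theta>"
    by (rule algebraic_int_if_stabilizes_ideal[OF x q0])
  show "\<theta> \<noteq> ev h x"
  proof
    assume "\<theta> = ev h x"
    \<comment> \<open>Reducing \<open>h\<close> modulo \<open>g\<close> to \<open>r\<close> leaves
      \<open>[:q:] * r - ?W\<close> vanishing at \<open>x\<close> with degree below that of
      \<open>g\<close>. It is zero, so \<open>q\<close> would divide the leading coefficient 1 of
      \<open>?W\<close>.\<close>
    let ?W = "\<pi> * C + [:q:] * B"
    obtain s r where sr: "h = g * s + r" "r = 0 \<or> degree r < degree g"
      using monic_division[OF g(2)] by blast
    have "ev h x = ev r x" using sr(1) g(3) by (simp add: ev_simps)
    then have "ev ([:q:] * r - ?W) x = 0"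
      using \<open>\<theta> = ev h x\<close> q0 unfolding \<theta>_def ev_simps(2) ev_simps(4)[of "[:q:]" r] ev_simps(6)
      by (simp add: field_simps)
    then have "g dvd [:q:] * r - ?W" by (rule min_poly_dvd[OF g])
    moreover have "degree ([:q:] * r - ?W) < degree g"
      using sr(2) W(2) by (intro degree_diff_less) auto
    ultimately have "[:q:] * r = ?W"
      using dvd_imp_degree_le by (metis eq_iff_diff_eq_0 not_less)
    then have "q dvd lead_coeff ?W" by (metis coeff_smult dvd_triv_left mult_pCons_left add_0_right mult_zero_left pCons_0_0)
    then show False using W(1) q by simp
  qed
qed

section \<open>Polynomial descriptions of Z[x] and Q(x), and reduction to prime denominators\<close>

lemma int_adjoin_eq: "int_adjoin x = range (\<lambda>h. ev h x)"
proof -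
  let ?R = "ring_of_type_algebra :: complex ring"
  interpret R: cring ?R by (rule cring_from_type_algebra)
  have R: "carrier ?R = UNIV" "\<And>a b. a \<otimes>\<^bsub>?R\<^esub> b = a * b" "\<And>a b. a \<oplus>\<^bsub>?R\<^esub> b = a + b"
    "\<one>\<^bsub>?R\<^esub> = 1" "\<zero>\<^bsub>?R\<^esub> = 0"
    by (simp_all add: ring_of_type_algebra_def)
  have inv: "\<ominus>\<^bsub>?R\<^esub> a = - a" for a
    using R.minus_equality[of "- a" a] R by auto
  show ?thesis
  proof (intro equalityI subsetI)
    fix y assume "y \<in> int_adjoin x"
    then have "y \<in> generate_ring ?R {x}" by (simp add: int_adjoin_def)
    then show "y \<in> range (\<lambda>h. ev h x)"
    proof (induction rule: generate_ring.induct)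
      case one
      then show ?case using R ev_simps(8)[of x] by (metis rangeI)
    next
      case (incl h)
      then have "h = ev [:0, 1:] x" by simp
      then show ?case by blast
    next
      case (a_inv h)
      then show ?case using inv by (auto simp: ev_simps(3)[symmetric])
    next
      case (eng_add a b)
      then show ?case using R by (auto simp: ev_simps(1)[symmetric])
    next
      case (eng_mult a b)
      then show ?case using R by (auto simp: ev_simps(4)[symmetric])
    qed
  next
    fix y assume "y \<in> range (\<lambda>h. ev h x)"
    then obtain h where y: "y = ev h x" by blast
    let ?G = "generate_ring ?R {x}"
    note add = generate_ring.eng_add[of _ ?R "{x}", unfolded R]
    note mult = generate_ring.eng_mult[of _ ?R "{x}", unfolded R]
    have one: "1 \<in> ?G" using generate_ring.one[of ?R "{x}"] by (simp add: R)
    have minus: "- a \<in> ?G" if "a \<in> ?G" for a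
      using generate_ring.a_inv[OF that] by (simp add: inv)
    have zero: "0 \<in> ?G" using add[OF one minus[OF one]] by simp
    have nat: "of_nat n \<in> ?G" for n
      by (induction n) (use zero one add in auto)
    have int: "of_int c \<in> ?G" for c
      by (cases c) (use nat minus in \<open>auto simp del: of_nat_Suc\<close>)
    have "ev h x \<in> ?G"
    proof (induction h)
      case (pCons c h)
      then show ?case
        unfolding ev_simps by (intro add[OF int mult[OF generate_ring.incl]]) auto
    qed (use zero in simp)
    then show "y \<in> int_adjoin x" by (simp add: y int_adjoin_def)
  qed
qed

text \<open>Cancelling powers of the variable, allowed as \<open>y\<close> is nonzero, gives a
  relation \<open>c + y P'(y) = 0\<close> with \<open>c\<close> nonzero, to be solved for the
  inverse.\<close>

lemma inverse_algebraic_int: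
  assumes "algebraic_int y" "y \<noteq> 0"
  obtains r m where "m \<noteq> 0" "inverse y = ev r y / of_int m"
proof -
  obtain P :: "int poly" where P: "ev P y = 0" "P \<noteq> 0"
    using assms(1) unfolding algebraic_int_altdef_ipoly by (metis leading_coeff_0_iff zero_neq_one)
  then have "\<exists>P. ev P y = 0 \<and> coeff P 0 \<noteq> 0"
  proof (induction P)
    case (pCons c P)
    then show ?case
      using assms(2) by (cases "c = 0") (auto simp: ev_simps intro: exI[of _ "pCons c P"])
  qed simp
  then obtain P where "ev P y = 0" "coeff P 0 \<noteq> 0" by blast
  then obtain c P' where P': "c \<noteq> 0" "of_int c + y * ev P' y = 0"
    by (cases P) (auto simp: ev_simps)
  then have "inverse y = ev (- P') y / of_int c"
    using assms(2) by (simp add: ev_simps field_simps add_eq_0_iff)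
  then show ?thesis using that P'(1) by blast
qed

text \<open>The fractions are closed under inversion because \<open>k(x)\<close> is itself an
  algebraic integer, so its inverse is a polynomial in \<open>k(x)\<close> over an integer, and
  composition makes this a polynomial in \<open>x\<close>.\<close>

lemma rat_adjoin_eq:
  assumes "algebraic_int x"
  shows "rat_adjoin x = {ev h x / of_int m | h m. m \<noteq> 0}"
proof -
  let ?R = "ring_of_type_algebra :: complex ring"
  interpret R: field ?R by (rule field_from_type_algebra)
  have R: "carrier ?R = UNIV" "\<And>a b. a \<otimes>\<^bsub>?R\<^esub> b = a * b" "\<And>a b. a \<oplus>\<^bsub>?R\<^esub> b = a + b"
    "\<one>\<^bsub>?R\<^esub> = 1" "\<zero>\<^bsub>?R\<^esub> = 0"
    by (simp_all add: ring_of_type_algebra_def)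
  have neg: "\<ominus>\<^bsub>?R\<^esub> a = - a" for a
    using R.minus_equality[of "- a" a] R by auto
  have inv: "inv\<^bsub>?R\<^esub> a = inverse a" if "a \<noteq> 0" for a
    using R.comm_inv_char[of a "inverse a"] R that by simp
  let ?K = "{ev h x / of_int m | h m. m \<noteq> 0}"
  have KI: "y \<in> ?K" if "m \<noteq> 0" "y = ev h x / of_int m" for y h m
    using that by blast
  have comp: "ev r (ev h x) = ev (pcompose r h) x" for r h
    by (induction r) (simp_all add: pcompose_pCons ev_simps)
  show ?thesis
  proof (intro equalityI subsetI)
    fix y assume "y \<in> rat_adjoin x"
    then have "y \<in> generate_field ?R {x}" by (simp add: rat_adjoin_def)
    then show "y \<in> ?K"
    proof (induction rule: generate_field.induct)
      case one
      show ?case by (rule KI[of 1 _ 1]) (simp_all add: R)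
    next
      case (incl h)
      then show ?case by (intro KI[of 1 _ "[:0, 1:]"]) simp_all
    next
      case (a_inv h)
      then obtain k m where "h = ev k x / of_int m" "m \<noteq> 0" by blast
      then show ?case by (intro KI[of m _ "- k"]) (simp_all add: neg ev_simps)
    next
      case (m_inv h)
      then obtain k m where k: "h = ev k x / of_int m" "m \<noteq> 0" by blast
      have "h \<noteq> 0" using m_inv R by simp
      then have "ev k x \<noteq> 0" using k by simp
      then obtain r c where r: "c \<noteq> 0" "inverse (ev k x) = ev r (ev k x) / of_int c"
        using inverse_algebraic_int[OF algebraic_int_ev[OF assms]] by blast
      have "inverse h = of_int m * inverse (ev k x)" using k by (simp add: divide_inverse)
      also have "\<dots> = ev ([:m:] * pcompose r k) x / of_int c"
        unfolding r comp ev_simps by simp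
      finally show ?case using r(1) inv[OF \<open>h \<noteq> 0\<close>] by (intro KI) auto
    next
      case (eng_add a b)
      then obtain k m l n where "a = ev k x / of_int m" "m \<noteq> 0" "b = ev l x / of_int n" "n \<noteq> 0" by blast
      then show ?case
        by (intro KI[of "m * n" _ "smult n k + smult m l"]) (auto simp: R ev_simps field_simps)
    next
      case (eng_mult a b)
      then obtain k m l n where "a = ev k x / of_int m" "m \<noteq> 0" "b = ev l x / of_int n" "n \<noteq> 0" by blast
      then show ?case
        by (intro KI[of "m * n" _ "k * l"]) (auto simp: R ev_simps)
    qed
  next
    fix y assume "y \<in> ?K"
    then obtain h m where y: "m \<noteq> 0" "y = ev h x / of_int m" by blast
    let ?G = "generate_field ?R {x}"
    note mult = generate_field.eng_mult[of _ ?R "{x}", unfolded R]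
    have sub: "generate_ring ?R {x} \<subseteq> ?G"
    proof
      fix z assume "z \<in> generate_ring ?R {x}"
      then show "z \<in> ?G"
        by (induction rule: generate_ring.induct) (auto intro: generate_field.intros)
    qed
    have ev_in: "ev k x \<in> ?G" for k
      using sub int_adjoin_eq[of x] by (auto simp: int_adjoin_def)
    have "of_int m \<in> ?G" using ev_in[of "[:m:]"] by (simp add: ev_simps)
    then have "inverse (of_int m) \<in> ?G"
      using generate_field.m_inv[of "of_int m" ?R "{x}"] inv[of "of_int m"] y(1) R by simp
    from mult[OF ev_in this] show "y \<in> rat_adjoin x"
      by (simp add: y rat_adjoin_def divide_inverse)
  qed
qed

lemma integer_ring_eq_iff:
  assumes "algebraic_int x"
  shows "ring_of_integers (rat_adjoin x) = int_adjoin x \<longleftrightarrow>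
    (\<forall>h m. m \<noteq> 0 \<longrightarrow> algebraic_int (ev h x / of_int m) \<longrightarrow> (\<exists>k. ev h x / of_int m = ev k x))"
proof -
  have "ev k x \<in> ring_of_integers (rat_adjoin x)" for k
    unfolding ring_of_integers_def rat_adjoin_eq[OF assms]
    using algebraic_int_ev[OF assms] by (auto intro!: exI[of _ k] exI[of _ "1 :: int"])
  then have "ring_of_integers (rat_adjoin x) = int_adjoin x \<longleftrightarrow>
      ring_of_integers (rat_adjoin x) \<subseteq> range (\<lambda>h. ev h x)"
    unfolding int_adjoin_eq by blast
  also have "\<dots> \<longleftrightarrow>
      (\<forall>h m. m \<noteq> 0 \<longrightarrow> algebraic_int (ev h x / of_int m) \<longrightarrow> (\<exists>k. ev h x / of_int m = ev k x))"
    unfolding ring_of_integers_def rat_adjoin_eq[OF assms] by blast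
  finally show ?thesis .
qed

text \<open>Strip primes off the denominator. If \<open>h(x) / q\<close> lies in Z[x], pass to the
  smaller denominator; otherwise it is the witness, being integral as an integer multiple of the
  given integral fraction.\<close>

lemma non_maximal_prime:
  assumes "algebraic_int x" "ring_of_integers (rat_adjoin x) \<noteq> int_adjoin x"
  obtains q :: int and h where "prime q" "algebraic_int (ev h x / of_int q)"
    "\<And>t. ev h x / of_int q \<noteq> ev t x"
proof -
  obtain h m where "m \<noteq> 0" "algebraic_int (ev h x / of_int m)" "\<And>k. ev h x / of_int m \<noteq> ev k x"
    using assms integer_ring_eq_iff[OF assms(1)] by blast
  then have "\<exists>q h. prime q \<and> algebraic_int (ev h x / of_int q) \<and> (\<forall>k. ev h x / of_int q \<noteq> ev k x)"
  proof (induction m arbitrary: h rule: prime_divisors_induct)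
    case zero
    then show ?case by simp
  next
    case (unit u)
    then have "u = 1 \<or> u = - 1" by auto
    then have "ev h x / of_int u = ev (smult u h) x" by (auto simp: ev_simps)
    then show ?case using unit.prems by blast
  next
    case (factor q m)
    show ?case
    proof (cases "\<exists>k. ev h x / of_int q = ev k x")
      case True
      then obtain k where k: "ev h x / of_int q = ev k x" by blast
      have eq: "ev h x / of_int (q * m) = ev k x / of_int m" 
        by (simp flip: k)
      show ?thesis
        using factor.IH[of k] factor.prems unfolding eq by auto
    next
      case False
      have "ev h x / of_int q = of_int m * (ev h x / of_int (q * m))"
        using factor.prems(1) by simp
      moreover have "algebraic_int (of_int m :: complex)"
        by (rule int_imp_algebraic_int) simp
      ultimately have "algebraic_int (ev h x / of_int q)"
        using factor.prems(2) algebraic_int_times by metis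
      then show ?thesis using False factor.hyps by blast
    qed
  qed
  then show ?thesis using that by blast
qed

section \<open>Eisenstein polynomials and congruences modulo a prime\<close>

lemma const_dvd_poly: "[:q:] dvd h \<Longrightarrow> q dvd poly h c" for q c :: int and h
  by auto

text \<open>At the least index \<open>i\<close> where \<open>q\<close> does not divide the
  coefficient of \<open>u\<close>, the coefficient of the product is that coefficient times
  \<open>coeff v 0\<close> modulo \<open>q\<close>.\<close>

lemma low_coeff_not_dvd_mult:
  fixes u v :: "int poly"
  assumes "prime q" "\<not> q dvd coeff v 0" "\<not> q dvd lead_coeff u"
  shows "\<exists>i\<le>degree u. \<not> q dvd coeff (u * v) i"
proof -
  define i where "i = (LEAST i. \<not> q dvd coeff u i)"
  have i: "\<not> q dvd coeff u i" unfolding i_def using assms(3) by (rule LeastI)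
  have below: "q dvd coeff u j" if "j < i" for j
    using not_less_Least[of j "\<lambda>i. \<not> q dvd coeff u i"] that by (auto simp: i_def)
  have "coeff (u * v) i = (\<Sum>j<i. coeff u j * coeff v (i - j)) + coeff u i * coeff v 0"
    by (simp add: coeff_mult lessThan_Suc_atMost[symmetric])
  moreover have "q dvd (\<Sum>j<i. coeff u j * coeff v (i - j))"
    using below by (intro dvd_sum) auto
  moreover have "\<not> q dvd coeff u i * coeff v 0"
    using i assms by (simp add: prime_dvd_mult_iff)
  ultimately have "\<not> q dvd coeff (u * v) i" by (simp add: dvd_add_right_iff)
  moreover have "i \<le> degree u" unfolding i_def using assms(3) by (rule Least_le)
  ultimately show ?thesis by blast
qed

text \<open>Eisenstein for \<open>G = g(X + c)\<close>, which is a pure power of X modulo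
  \<open>q\<close> and has constant term \<open>g(c)\<close>.\<close>

lemma irreducible_eisenstein:
  fixes g :: "int poly" and q c :: int
  assumes "prime q" "lead_coeff g = 1" "degree g > 0"
    and mod_q: "[:q:] dvd g - [:- c, 1:] ^ degree g" and "\<not> q\<^sup>2 dvd poly g c"
  shows "irreducible g"
proof -
  let ?s = "[:c, 1:]"
  define G where "G = pcompose g ?s"
  define d where "d = degree g"
  have low: "q dvd coeff G i" if "i < d" for i
  proof -
    obtain t where "g - [:- c, 1:] ^ d = [:q:] * t" using mod_q by (auto simp: d_def)
    then have g: "g = [:- c, 1:] ^ d + [:q:] * t" by (simp add: algebra_simps)
    have "G = monom 1 d + [:q:] * pcompose t ?s"
      by (simp add: poly_eq_poly_eq_iff[symmetric] fun_eq_iff G_def g poly_pcompose poly_monom)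
    then show ?thesis using that by simp
  qed
  have G0: "coeff G 0 = poly g c" by (simp add: G_def poly_0_coeff_0[symmetric] poly_pcompose)
  have "u dvd 1 \<or> v dvd 1" if uv: "g = u * v" for u v
  proof (rule ccontr)
    assume non_unit: "\<not> (u dvd 1 \<or> v dvd 1)"
    have lc: "lead_coeff u dvd 1" "lead_coeff v dvd 1"
      using assms(2) unfolding uv lead_coeff_mult by (metis dvd_triv_left, metis dvd_triv_right)
    have pos: "degree w > 0" if "lead_coeff w dvd 1" "\<not> w dvd 1" for w :: "int poly"
      using that by (metis degree_0_id gr0I is_unit_const_poly_iff lead_coeff_pCons(2) one_pCons pCons_0_0 coeff_pCons_0)
    have "u \<noteq> 0" "v \<noteq> 0" using lc by auto
    then have d: "d = degree u + degree v" using uv by (simp add: d_def degree_mult_eq)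
    have "degree u < d" "degree v < d" using d pos lc non_unit by auto
    \<comment> \<open>If the shifted \<open>z\<close> has constant term prime to \<open>q\<close>,
      the product has a coefficient of index at most \<open>degree w < d\<close> not divisible by
      \<open>q\<close>. So both shifted factors have constant terms divisible by \<open>q\<close>,
      against the condition on \<open>g(c)\<close>.\<close>
    have contra: False
      if "g = w * z" "degree w < d" "lead_coeff w dvd 1" "\<not> q dvd coeff (pcompose z ?s) 0" for w z
    proof -
      have deg: "degree (pcompose w ?s) = degree w" by simp
      have "lead_coeff (pcompose w ?s) = lead_coeff w" using lead_coeff_comp[of ?s w] by simp
      then have "\<not> q dvd lead_coeff (pcompose w ?s)"
        using that(3) assms(1) by (metis dvd_trans not_prime_unit)
      from low_coeff_not_dvd_mult[OF assms(1) that(4) this] obtain i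
        where "i \<le> degree w" "\<not> q dvd coeff (pcompose w ?s * pcompose z ?s) i"
        unfolding deg by blast
      then show False using low[of i] that(1,2) by (simp add: G_def pcompose_mult)
    qed
    have "\<not> (q dvd coeff (pcompose u ?s) 0 \<and> q dvd coeff (pcompose v ?s) 0)"
    proof
      assume "q dvd coeff (pcompose u ?s) 0 \<and> q dvd coeff (pcompose v ?s) 0"
      then have "q * q dvd coeff (pcompose u ?s) 0 * coeff (pcompose v ?s) 0" by (simp add: mult_dvd_mono)
      also have "\<dots> = coeff G 0" by (simp add: G_def uv pcompose_mult coeff_mult_0)
      finally show False using assms(5) G0 by (simp add: power2_eq_square)
    qed
    then show False
      using contra[of u v] contra[of v u] uv lc \<open>degree u < d\<close> \<open>degree v < d\<close> by (auto simp: mult.commute)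
  qed
  moreover have "\<not> g dvd 1"
    using assms(3) by (metis dvd_imp_degree_le degree_1 not_le zero_neq_one)
  moreover have "g \<noteq> 0" using assms(2) by auto
  ultimately show ?thesis by (intro irreducibleI) 
qed

section \<open>Congruences for p-th powers\<close>

lemma diff_dvd_power_diff:
  fixes x y :: "'a :: comm_ring_1"
  shows "x - y dvd x ^ n - y ^ n"
  by (simp add: power_diff_sumr2)

lemma prime_dvd_binomial_power_diff:
  fixes x y :: "'a :: comm_ring_1"
  assumes "prime p"
  shows "of_nat p dvd (x + y) ^ p - (x ^ p + y ^ p)"
proof -
  have p: "p > 0" using assms by (simp add: prime_gt_0_nat)
  let ?t = "\<lambda>k. of_nat (p choose k) * x ^ k * y ^ (p - k)"
  have "(x + y) ^ p = (\<Sum>k\<le>p. ?t k)" by (rule binomial_ring)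
  also have "{..p} = insert 0 (insert p {1..<p})" using p by auto
  also have "(\<Sum>k\<in>\<dots>. ?t k) = y ^ p + (x ^ p + (\<Sum>k=1..<p. ?t k))"
    using p by (subst sum.insert) auto
  finally have "(x + y) ^ p - (x ^ p + y ^ p) = (\<Sum>k=1..<p. ?t k)" by simp
  also have "of_nat p dvd \<dots>"
  proof (rule dvd_sum)
    fix k assume "k \<in> {1..<p}"
    then have "p dvd p choose k" using assms p by (intro dvd_choose_prime) auto
    then have "(of_nat p :: 'a) dvd of_nat (p choose k)" by (metis dvdE dvd_triv_left of_nat_mult)
    then show "of_nat p dvd ?t k" by (simp add: mult.assoc)
  qed
  finally show ?thesis .
qed

lemma fermat_int:
  assumes "prime p"
  shows "int p dvd c ^ p - c"
proof -
  \<comment> \<open>The equivalence allows induction from 0 in both directions.\<close>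
  have step: "int p dvd (c + 1) ^ p - (c + 1) \<longleftrightarrow> int p dvd c ^ p - c" for c
  proof -
    have eq: "(c + 1) ^ p - (c + 1) = ((c + 1) ^ p - (c ^ p + 1 ^ p)) + (c ^ p - c)" by simp
    have "int p dvd (c + 1) ^ p - (c ^ p + 1 ^ p)"
      using prime_dvd_binomial_power_diff[OF assms, of c 1] by simp
    then show ?thesis unfolding eq by (rule dvd_add_right_iff)
  qed
  show ?thesis
  proof (induction c rule: int_induct[of _ 0])
    case base
    then show ?case using prime_gt_0_nat[OF assms] by (simp add: power_0_left)
  next
    case (step1 i)
    then show ?case using step by simp
  next
    case (step2 i)
    then show ?case using step[of "i - 1"] by simp
  qed
qed

text \<open>Each further p-th power is additive modulo \<open>p\<close>, and Fermat's theorem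
  returns the constant to \<open>c\<close>.\<close>

lemma frobenius_add_const:
  assumes "prime p"
  shows "[:int p:] dvd (A + [:c:]) ^ (p ^ m) - (A ^ (p ^ m) + [:c:])"
proof (induction m)
  case (Suc m)
  let ?B = "A ^ (p ^ m)"
  have "[:int p:] dvd ((A + [:c:]) ^ (p ^ m)) ^ p - (?B + [:c:]) ^ p"
    using Suc diff_dvd_power_diff dvd_trans by blast
  moreover have "[:int p:] dvd (?B + [:c:]) ^ p - (?B ^ p + [:c:] ^ p)"
    using prime_dvd_binomial_power_diff[OF assms, of ?B "[:c:]"] by (simp add: of_nat_poly)
  moreover have "[:int p:] dvd [:c:] ^ p - [:c:]"
    using fermat_int[OF assms, of c] by (simp add: const_poly_dvd poly_const_pow)
  ultimately have "[:int p:] dvd (((A + [:c:]) ^ (p ^ m)) ^ p - (?B + [:c:]) ^ p) +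
      ((?B + [:c:]) ^ p - (?B ^ p + [:c:] ^ p)) + ([:c:] ^ p - [:c:])"
    by (intro dvd_add)
  also have "\<dots> = (A + [:c:]) ^ (p ^ Suc m) - (A ^ (p ^ Suc m) + [:c:])"
    by (simp add: power_mult[symmetric] mult.commute)
  finally show ?case .
qed simp

text \<open>The cofactor of \<open>b - a\<close> is a sum of \<open>p\<close> terms, all congruent
  to \<open>a ^ (p - 1)\<close> modulo \<open>p\<close>, and so supplies the second factor
  \<open>p\<close>.\<close>

lemma power_prime_cong_square:
  fixes a b :: int
  assumes "int p dvd b - a"
  shows "(int p)\<^sup>2 dvd b ^ p - a ^ p"
proof (cases p)
  case (Suc n)
  have "b ^ p - a ^ p = (b - a) * (\<Sum>i<p. b ^ i * a ^ (n - i))"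
    unfolding Suc by (rule diff_power_eq_sum)
  moreover have "[(\<Sum>i<p. b ^ i * a ^ (n - i)) = (\<Sum>i<p. a ^ n)] (mod int p)"
  proof (rule cong_sum)
    fix i assume "i \<in> {..<p}"
    then have "a ^ n = a ^ i * a ^ (n - i)" using Suc by (simp flip: power_add)
    moreover have "[b = a] (mod int p)" using assms by (simp add: cong_iff_dvd_diff)
    ultimately show "[b ^ i * a ^ (n - i) = a ^ n] (mod int p)"
      by (simp add: cong_mult cong_pow)
  qed
  then have "int p dvd (\<Sum>i<p. b ^ i * a ^ (n - i))"
    by (simp add: cong_dvd_iff)
  ultimately show ?thesis using assms by (simp add: power2_eq_square mult_dvd_mono)
qed (use assms in auto)

text \<open>The hypotheses on the Taylor expansion at \<open>c\<close> put \<open>g\<close> into the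
  square of \<open>(q, X - c)\<close>. Here \<open>q\<close> may be composite, which suits an
  arbitrary square divisor.\<close>

lemma not_integer_ring_if_dvd:
  fixes g :: "int poly" and q c :: int
  assumes g: "irreducible g" "lead_coeff g = 1" "ev g x = 0" and q: "\<bar>q\<bar> \<ge> 2"
    and dvd: "q\<^sup>2 dvd poly g c" "q dvd poly (pderiv g) c"
  shows "ring_of_integers (rat_adjoin x) \<noteq> int_adjoin x"
proof -
  let ?\<pi> = "[:- c, 1:]"
  have x: "algebraic_int x" using g by (auto simp: algebraic_int_altdef_ipoly)
  obtain A where A: "poly g c = q * q * A" using dvd(1) by (auto simp: power2_eq_square)
  obtain B where B: "poly (pderiv g) c = q * B" using dvd(2) by blast
  \<comment> \<open>\<open>H\<close> is the difference quotient of \<open>g\<close> at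
    \<open>c\<close>, so \<open>H(c) = g'(c)\<close>. It is also the monic numerator for
    \<open>dedekind_non_integral\<close>: the extra integral element is
    \<open>H(x) / q\<close>.\<close>
  define H where "H = synthetic_div g c"
  define C where "C = synthetic_div H c"
  have g_eq: "g = ?\<pi> * H + [:poly g c:]"
    unfolding H_def by (rule synthetic_div_correct'[symmetric])
  have "pderiv g = H + ?\<pi> * pderiv H"
    by (subst g_eq) (simp add: pderiv_add pderiv_mult pderiv_pCons mult.commute del: mult_pCons_left mult_pCons_right)
  then have "poly (pderiv g) c = poly H c" by simp
  then have H_eq: "H = ?\<pi> * C + [:q:] * [:B:]"
    using synthetic_div_correct'[of c H, folded C_def] B by (simp add: mult.commute)
  have deg: "degree g > 0"
  proof (rule ccontr)
    assume "\<not> degree g > 0"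
    then have "g = 1" using g(2) by (metis degree_0_id gr0I one_pCons)
    then show False using g(3) by simp
  qed
  have "H \<noteq> 0"
    using deg g_eq by (metis degree_pCons_0 less_irrefl mult_zero_right add_0)
  have "degree g = degree (?\<pi> * H) \<and> lead_coeff g = lead_coeff (?\<pi> * H)"
  proof -
    have less: "degree [:poly g c:] < degree (?\<pi> * H)"
      using \<open>H \<noteq> 0\<close> by (subst degree_mult_eq) auto
    show ?thesis
      using degree_add_eq_left[OF less] lead_coeff_add_le[OF less]
      unfolding add.commute[of "[:poly g c:]"] g_eq[symmetric] by blast
  qed
  then have H: "degree H < degree g" "lead_coeff H = 1"
    using \<open>H \<noteq> 0\<close> g(2) lead_coeff_mult[of ?\<pi> H] by (auto simp: degree_mult_eq simp del: mult_pCons_left)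
  have "g = [:q:] * [:q:] * [:A:] + [:q:] * ?\<pi> * [:B:] + ?\<pi> * ?\<pi> * C"
  proof -
    have "g = ?\<pi> * (?\<pi> * C + [:q:] * [:B:]) + [:q * q * A:]"
      using g_eq unfolding H_eq[symmetric] A .
    also have "[:q * q * A:] = [:q:] * [:q:] * [:A:]" by simp
    finally show ?thesis by (simp only: distrib_left ac_simps)
  qed
  from dedekind_non_integral[OF g q this, folded H_eq] H
  have "algebraic_int (ev H x / of_int q)" "\<And>h. ev H x / of_int q \<noteq> ev h x" by auto
  moreover have "q \<noteq> 0" using q by auto
  ultimately show ?thesis unfolding integer_ring_eq_iff[OF x] by blast
qed

section \<open>Iterates of a pure binomial\<close>

locale prime_power_iterates =
  fixes p :: nat and a :: int
  assumes prime_p: "prime p"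
begin

definition iter :: "nat \<Rightarrow> int poly" where
  "iter n = poly_iterate (monom 1 p - [:a:]) n"

lemma iter_0: "iter 0 = [:0, 1:]"
  by (simp add: iter_def poly_iterate_def)

lemma iter_Suc: "iter (Suc n) = iter n ^ p - [:a:]"
  by (simp add: iter_def poly_iterate_def poly_eq_poly_eq_iff[symmetric] fun_eq_iff poly_pcompose poly_monom)

lemma poly_iter: "poly (iter n) x = ((\<lambda>y. y ^ p - a) ^^ n) x"
  by (induction n) (auto simp: iter_0 iter_Suc)

lemma iter_add: "iter (j + k) = pcompose (iter j) (iter k)"
  by (simp add: poly_eq_poly_eq_iff[symmetric] fun_eq_iff poly_pcompose poly_iter funpow_add)

lemma p_ge_2: "p \<ge> 2"
  using prime_p by (rule prime_ge_2_nat)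

lemma
  shows degree_iter: "degree (iter n) = p ^ n" and lead_coeff_iter: "lead_coeff (iter n) = 1"
proof (induction n)
  case (Suc n)
  have "iter n \<noteq> 0" using Suc(2) by auto
  then have deg: "degree (iter n ^ p) = p ^ Suc n" using Suc(1) by (simp add: degree_power_eq)
  moreover have "degree [:- a:] < degree (iter n ^ p)" using deg p_ge_2 by simp
  moreover have "lead_coeff (iter n ^ p) = 1" using Suc(2) by (simp add: lead_coeff_power)
  moreover have "iter (Suc n) = iter n ^ p + [:- a:]" by (simp add: iter_Suc)
  ultimately show "degree (iter (Suc n)) = p ^ Suc n" "lead_coeff (iter (Suc n)) = 1"
    by (metis degree_add_eq_left, metis lead_coeff_add_le add.commute)
qed (auto simp: iter_0)

text \<open>Frobenius absorbs the new constant \<open>- a\<close> into the linear form, moving its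
  root from \<open>n * a\<close> to \<open>(n + 1) * a\<close>.\<close>

lemma iter_mod_p: "[:int p:] dvd iter n - [:- (int n * a), 1:] ^ (p ^ n)"
proof (induction n)
  case 0
  then show ?case by (simp add: iter_0)
next
  case (Suc n)
  let ?A = "[:- (int n * a), 1:]"
  have "[:int p:] dvd iter n ^ p - (?A ^ (p ^ n)) ^ p"
    using Suc diff_dvd_power_diff dvd_trans by blast
  moreover have "[:int p:] dvd (?A + [:- a:]) ^ (p ^ Suc n) - (?A ^ (p ^ Suc n) + [:- a:])"
    by (rule frobenius_add_const[OF prime_p])
  ultimately have "[:int p:] dvd (iter n ^ p - (?A ^ (p ^ n)) ^ p) -
      ((?A + [:- a:]) ^ (p ^ Suc n) - (?A ^ (p ^ Suc n) + [:- a:]))"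
    by (rule dvd_diff)
  also have "\<dots> = iter (Suc n) - (?A + [:- a:]) ^ (p ^ Suc n)"
    by (simp add: iter_Suc power_mult[symmetric] mult.commute)
  also have "?A + [:- a:] = [:- (int (Suc n) * a), 1:]" by (simp add: algebra_simps)
  finally show ?case .
qed

text \<open>With \<open>n = k + 1\<close>, the value \<open>b\<close> of the k-th iterate at
  \<open>n * a\<close> is \<open>(n * a - k * a) ^ (p ^ k)\<close> modulo \<open>p\<close>, hence
  \<open>a\<close>. Therefore \<open>b ^ p - a\<close> is congruent to \<open>a ^ p - a\<close>
  modulo the square of \<open>p\<close>.\<close>

lemma iter_shift_not_dvd:
  assumes "\<not> [a ^ p = a] (mod (int p)\<^sup>2)" "n \<ge> 1"
  shows "\<not> (int p)\<^sup>2 dvd poly (iter n) (int n * a)"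
proof
  assume dvd: "(int p)\<^sup>2 dvd poly (iter n) (int n * a)"
  obtain k where n: "n = Suc k" using assms(2) by (cases n) auto
  define b where "b = poly (iter k) (int n * a)"
  have "int p dvd b - (int n * a - int k * a) ^ (p ^ k)"
    using const_dvd_poly[OF iter_mod_p[of k], of "int n * a"] by (simp add: b_def)
  also have "int n * a - int k * a = a" by (simp add: n algebra_simps)
  finally have "int p dvd b - a ^ (p ^ k)" .
  moreover have "int p dvd a ^ (p ^ k) - a"
    using const_dvd_poly[OF frobenius_add_const[OF prime_p, of 0 a k], of 0] p_ge_2
    by (simp add: power_0_left)
  ultimately have "int p dvd (b - a ^ (p ^ k)) + (a ^ (p ^ k) - a)" by (rule dvd_add)
  then have "int p dvd b - a" by simp
  then have "(int p)\<^sup>2 dvd b ^ p - a ^ p" by (rule power_prime_cong_square)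
  moreover have "(int p)\<^sup>2 dvd b ^ p - a"
    using dvd by (simp add: n iter_Suc b_def)
  ultimately have "(int p)\<^sup>2 dvd (b ^ p - a) - (b ^ p - a ^ p)" by (rule dvd_diff[rotated])
  then show False using assms(1) by (simp add: cong_iff_dvd_diff)
qed

lemma irreducible_iter:
  assumes "\<not> [a ^ p = a] (mod (int p)\<^sup>2)" "n \<ge> 1"
  shows "irreducible (iter n)"
proof (rule irreducible_eisenstein)
  show "prime (int p)" using prime_p by simp
  show "degree (iter n) > 0" using p_ge_2 by (simp add: degree_iter)
  show "[:int p:] dvd iter n - [:- (int n * a), 1:] ^ degree (iter n)"
    unfolding degree_iter by (rule iter_mod_p)
qed (use lead_coeff_iter iter_shift_not_dvd[OF assms] in auto)

lemma pderiv_iter: "pderiv (iter n) = [:int (p ^ n):] * (\<Prod>k<n. iter k ^ (p - 1))"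
proof (induction n)
  case (Suc n)
  have "pderiv (h ^ p) = [:int p:] * (h ^ (p - 1)) * pderiv h" for h :: "int poly"
    by (cases p) (simp_all add: pderiv_power_Suc del: power_Suc)
  then have "pderiv (iter (Suc n)) = [:int p:] * (iter n ^ (p - 1)) * pderiv (iter n)"
    by (simp add: iter_Suc pderiv_diff pderiv_pCons)
  also have "\<dots> = ([:int p:] * [:int (p ^ n):]) * ((\<Prod>k<n. iter k ^ (p - 1)) * iter n ^ (p - 1))"
    unfolding Suc by (simp only: ac_simps)
  finally show ?case by (simp add: mult.commute)
qed (simp add: iter_0 pderiv_pCons)

text \<open>The first iterate is \<open>X ^ p - a\<close> with \<open>p \<ge> 2\<close>; afterwards
  a difference of p-th powers is divisible by the difference of the bases. Substituting an iterate
  \<open>Y\<close> for X gives a congruence modulo \<open>Y * Y\<close>.\<close>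

lemma iter_const_term:
  assumes "n \<ge> 1"
  obtains G where "iter n = [:poly (iter n) 0:] + [:0, 1:] * [:0, 1:] * G"
proof -
  have "[:0, 1:] * [:0, 1:] dvd iter n - [:poly (iter n) 0:]"
    using assms
  proof (induction n rule: nat_induct_at_least)
    case base
    have "iter 1 - [:poly (iter 1) 0:] = [:0, 1:] ^ p"
      using p_ge_2 by (simp add: iter_Suc iter_0 power_0_left)
    also have "[:0, 1:] ^ 2 dvd ([:0, 1:] :: int poly) ^ p"
      using p_ge_2 by (rule le_imp_power_dvd)
    finally show ?case by (simp only: power2_eq_square)
  next
    case (Suc n)
    let ?b = "poly (iter n) 0"
    have "iter (Suc n) - [:poly (iter (Suc n)) 0:] = iter n ^ p - [:?b:] ^ p"
      by (simp add: iter_Suc poly_const_pow)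
    then show ?case
      using Suc.IH diff_dvd_power_diff dvd_trans by metis
  qed
  then obtain G where "iter n - [:poly (iter n) 0:] = [:0, 1:] * [:0, 1:] * G" by blast
  then have "iter n = [:poly (iter n) 0:] + [:0, 1:] * [:0, 1:] * G" by (simp only: diff_eq_eq add.commute)
  then show ?thesis by (rule that)
qed

lemma iter_maximal:
  assumes np: "\<not> [a ^ p = a] (mod (int p)\<^sup>2)" and n: "n \<ge> 1"
    and sqf: "\<And>j. 1 \<le> j \<Longrightarrow> j \<le> n \<Longrightarrow> squarefree (poly (iter j) 0)"
    and root: "ev (iter n) x = 0"
  shows "ring_of_integers (rat_adjoin x) = int_adjoin x"
proof (rule ccontr)
  note g = irreducible_iter[OF np n] lead_coeff_iter[of n] root
  have x: "algebraic_int x" using g by (auto simp: algebraic_int_altdef_ipoly)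
  assume "ring_of_integers (rat_adjoin x) \<noteq> int_adjoin x"
  from non_maximal_prime[OF x this] obtain q h where q: "prime q"
    "algebraic_int (ev h x / of_int q)" "\<And>t. ev h x / of_int q \<noteq> ev t x" by blast
  from dedekind_non_maximal[OF g q] obtain \<pi> U W F where "max_ideal q \<pi>"
    and eq: "iter n = U * W + [:q:] * F"
    and UWF: "U \<in> poly_ideal.span {[:q:], \<pi>}" "W \<in> poly_ideal.span {[:q:], \<pi>}"
      "F \<in> poly_ideal.span {[:q:], \<pi>}" by blast
  interpret max_ideal q \<pi> by fact
  have g_M: "iter n \<in> M"
    unfolding eq by (intro M_add M_mult_left[OF UWF(2)] M_mult_right[OF q_in_M])
  show False
  proof (cases "q = int p")
    case True
    define c where "c = int n * a"
    obtain T where "iter n - [:- c, 1:] ^ (p ^ n) = [:q:] * T"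
      using iter_mod_p[of n] unfolding True c_def by blast
    then have "[:- c, 1:] ^ (p ^ n) = iter n - [:q:] * T" by (simp add: algebra_simps)
    then have "[:- c, 1:] ^ (p ^ n) \<in> M" using M_diff[OF g_M M_mult_right[OF q_in_M]] by metis
    then have lin: "[:- c, 1:] \<in> M" by (rule M_power)
    \<comment> \<open>As \<open>X - c\<close> lies in \<open>M\<close>, a polynomial and its value
      at \<open>c\<close> agree modulo \<open>M\<close>. Evaluating \<open>U * W + [:q:] * F\<close>
      at \<open>c\<close> then yields two factors \<open>q\<close>.\<close>
    have at_c: "q dvd poly k c" if "k \<in> M" for k
    proof -
      have "[:poly k c:] = k - [:- c, 1:] * synthetic_div k c"
        using synthetic_div_correct'[of c k] by (simp add: algebra_simps)
      then have "[:poly k c:] \<in> M" using M_diff[OF that M_mult_right[OF lin]] by metis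
      then show ?thesis by (simp add: const_in_M_iff)
    qed
    have "poly (iter n) c = poly U c * poly W c + q * poly F c" by (simp add: eq)
    moreover have "q * q dvd poly U c * poly W c" "q * q dvd q * poly F c"
      using at_c UWF by (auto intro: mult_dvd_mono)
    ultimately have "q\<^sup>2 dvd poly (iter n) c" by (simp add: power2_eq_square)
    then show False using iter_shift_not_dvd[OF np n] by (simp add: True c_def)
  next
    case False
    \<comment> \<open>By the product rule the derivative lies in \<open>M\<close>. The factor
      \<open>p ^ n\<close> does not, because \<open>q\<close> differs from \<open>p\<close>, so some
      earlier iterate does.\<close>
    have "pderiv (iter n) = U * pderiv W + W * pderiv U + [:q:] * pderiv F"
      unfolding eq by (simp add: pderiv_add pderiv_mult pderiv_smult)
    then have "pderiv (iter n) \<in> M" using UWF q_in_M M_add M_mult_right by metis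
    then have "[:int (p ^ n):] \<in> M \<or> (\<Prod>k<n. iter k ^ (p - 1)) \<in> M"
      unfolding pderiv_iter by (rule M_prime)
    moreover have "[:int (p ^ n):] \<notin> M"
    proof
      assume "[:int (p ^ n):] \<in> M"
      then have "q dvd int p ^ n" by (simp add: const_in_M_iff)
      then have "q dvd int p" using q(1) by (metis prime_dvd_power)
      then show False using False q(1) prime_p primes_dvd_imp_eq[of q "int p"] by simp
    qed
    ultimately obtain k where k: "k < n" "iter k ^ (p - 1) \<in> M" using M_prod by blast
    define Y where "Y = iter k"
    have Y: "Y \<in> M" unfolding Y_def using k(2) by (rule M_power)
    define b where "b = poly (iter (n - k)) 0"
    obtain G where G: "iter (n - k) = [:b:] + [:0, 1:] * [:0, 1:] * G"
      using iter_const_term[of "n - k"] k(1) unfolding b_def by (metis One_nat_def Suc_leI zero_less_diff)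
    define G' where "G' = pcompose G Y"
    have "iter n = iter (n - k + k)" using k by simp
    also have "\<dots> = pcompose (iter (n - k)) Y" by (simp only: iter_add Y_def)
    also have "\<dots> = [:b:] + Y * Y * G'"
      unfolding G G'_def by (simp only: pcompose_add pcompose_mult pcompose_const pcompose_idR pcompose_pCons) simp
    finally have g_eq: "iter n = [:b:] + Y * Y * G'" .
    then have b_eq: "[:b:] = U * W + [:q:] * F + (- G') * (Y * Y)"
      unfolding eq by (simp add: algebra_simps)
    \<comment> \<open>Membership in \<open>M\<close> gives a first factor \<open>q\<close> of
      \<open>b\<close>; cancelling it inside \<open>M2\<close> gives the second.\<close>
    have "[:b:] = iter n - Y * (Y * G')" unfolding g_eq by (simp add: mult.assoc)
    then have "[:b:] \<in> M" using M_diff[OF g_M M_mult_right[OF Y]] by metis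
    then obtain b' where b': "b = q * b'" by (auto simp: const_in_M_iff)
    have "[:b:] \<in> M2"
      unfolding b_eq using UWF Y by (intro M2_add M2_mult_left mult_in_M2 q_in_M)
    then have "[:q:] * [:b':] \<in> M2" by (simp add: b' mult.commute)
    then have "[:b':] \<in> M" by (rule M2_cancel_q)
    then have "q\<^sup>2 dvd b" by (auto simp: const_in_M_iff b' power2_eq_square)
    moreover have "squarefree b" using sqf[of "n - k"] k(1) by (simp add: b_def)
    ultimately show False using q(1) by (auto simp: squarefree_def)
  qed
qed

text \<open>The factor with \<open>k = 0\<close> is \<open>X ^ (p - 1)\<close>, which vanishes at 0
  since \<open>p \<ge> 2\<close>.\<close>

lemma poly_pderiv_iter_0: "n \<ge> 1 \<Longrightarrow> poly (pderiv (iter n)) 0 = 0"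
  unfolding pderiv_iter using p_ge_2
  by (auto simp: poly_prod prod_zero_iff iter_0 intro!: bexI[of _ 0])

end

theorem theorem1p1:
  fixes p N :: nat and a :: int and f :: "int poly" and \<alpha> :: "nat \<Rightarrow> complex"
  assumes "prime p"
    and "f = monom 1 p - [:a:]"
    and "irreducible f"
    and "\<And>n. n \<ge> 1 \<Longrightarrow> poly (map_poly of_int (poly_iterate f n)) (\<alpha> n) = 0"
    and "N \<ge> 1"
  shows "(\<forall>n\<in>{1..N}. ring_of_integers (rat_adjoin (\<alpha> n)) = int_adjoin (\<alpha> n)) \<longleftrightarrow>
    \<not> [a ^ p = a] (mod (int p)\<^sup>2) \<and> (\<forall>n\<in>{1..N}. squarefree (poly (poly_iterate f n) 0))"
proof -
  interpret prime_power_iterates p a by unfold_locales fact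
  have iter: "poly_iterate f n = iter n" for n by (simp add: iter_def assms(2))
  have root: "ev (iter n) (\<alpha> n) = 0" if "n \<ge> 1" for n
    using assms(4)[OF that] by (simp add: iter)
  show ?thesis
  proof (intro iffI conjI ballI)
    assume max: "\<forall>n\<in>{1..N}. ring_of_integers (rat_adjoin (\<alpha> n)) = int_adjoin (\<alpha> n)"
    show np: "\<not> [a ^ p = a] (mod (int p)\<^sup>2)"
    proof
      assume "[a ^ p = a] (mod (int p)\<^sup>2)"
      \<comment> \<open>The test is applied with \<open>q = p\<close> and \<open>c = a\<close>,
        where \<open>f(a) = a ^ p - a\<close> and \<open>f'\<close> is a multiple of
        \<open>p\<close>.\<close>
      then have "(int p)\<^sup>2 dvd poly (iter 1) a"
        by (simp add: cong_iff_dvd_diff iter_Suc iter_0)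
      moreover have "int p dvd poly (pderiv (iter 1)) a" unfolding pderiv_iter by simp
      moreover have "irreducible (iter 1)"
        using assms(3) by (simp add: assms(2) iter_Suc iter_0 monom_altdef)
      ultimately have "ring_of_integers (rat_adjoin (\<alpha> 1)) \<noteq> int_adjoin (\<alpha> 1)"
        using lead_coeff_iter root[of 1] p_ge_2 by (intro not_integer_ring_if_dvd[of "iter 1"]) auto
      then show False using max assms(5) by simp
    qed
    fix n assume n: "n \<in> {1..N}"
    show "squarefree (poly (poly_iterate f n) 0)"
    proof (rule ccontr)
      assume "\<not> squarefree (poly (poly_iterate f n) 0)"
      then obtain z where z: "z\<^sup>2 dvd poly (iter n) 0" "\<not> z dvd 1"
        by (auto simp: squarefree_def iter)
      \<comment> \<open>If \<open>z = 0\<close> the iterate vanishes at 0, so any square divides it;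
        the value 2 secures the bound on the absolute value.\<close>
      define q where "q = (if z = 0 then 2 else z)"
      have "q\<^sup>2 dvd poly (iter n) 0" using z by (auto simp: q_def)
      moreover have "\<bar>q\<bar> \<ge> 2" using z by (auto simp: q_def zdvd1_eq)
      moreover have "q dvd poly (pderiv (iter n)) 0" using n by (simp add: poly_pderiv_iter_0)
      ultimately have "ring_of_integers (rat_adjoin (\<alpha> n)) \<noteq> int_adjoin (\<alpha> n)"
        using n root irreducible_iter[OF np] lead_coeff_iter
        by (intro not_integer_ring_if_dvd[of "iter n"]) auto
      then show False using max n by blast
    qed
  next
    fix n assume "\<not> [a ^ p = a] (mod (int p)\<^sup>2) \<and> (\<forall>n\<in>{1..N}. squarefree (poly (poly_iterate f n) 0))"
      and "n \<in> {1..N}"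
    then show "ring_of_integers (rat_adjoin (\<alpha> n)) = int_adjoin (\<alpha> n)"
      using root by (intro iter_maximal[of n]) (auto simp: iter)
  qed
qed

end
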